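(* Let $A=kQ/I$ be a special biserial algebra over an algebraically closed field $k$ (with $(Q,I)$ special biserial) such that $Q$ has no bypass. Then there is a short exact sequence of $k$-vector spaces $$0\to \mathrm{HH}^1(A)\xrightarrow{p^*}\mathrm{HH}^1(A/S)\to k^{\dim_k S}\to 0,$$ where $p^*$ is a morphism of Lie algebras.
   Context: Special biserial bound quiver $(Q,I)$: $Q$ finite connected, $I$ admissible in $kQ$, (i) every point is source of at most two arrows and target of at most two arrows; (ii) for each arrow $\alpha:x\to y$ at most one arrow $\beta$ starting at $y$ with $\alpha\beta\notin I$ and at most one arrow $\gamma$ ending at $x$ with $\gamma\alpha\notin I$. A bypass is a pair $(\alpha,p)$ with $\alpha$ an arrow and $p\neq\alpha$ a path with the same source and target as $\alpha$. $S$ is the socle of the direct sum of the pairwise non-isomorphic indecomposable non-uniserial projective-injective $A$-modules; it is a two-sided ideal of $A$, and $A/S\simeq kQ/J$ with $J$ generated by $I$ and all paths occurring in binomial relations of $I$. $\mathrm{HH}^1$ denotes first Hochschild cohomology (with coefficients in the algebra itself), endowed with its Lie algebra structure induced by the commutator of derivations. *)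

theory Defs
  imports "HOL-Computational_Algebra.Polynomial" "HOL-Library.Function_Algebras"
begin

section \<open>Quivers and paths\<close>

text \<open>A finite quiver is given by a finite vertex type 'v, a finite arrow type 'a and
source/target maps. A path is a start vertex together with a list of arrows,
composed left to right (alpha beta means: first alpha, then beta).
The trivial path at x is (x, []).\<close>

type_synonym ('v,'a) path = "'v \<times> 'a list"

definition vert_after :: "('a \<Rightarrow> 'v) \<Rightarrow> 'v \<Rightarrow> 'a list \<Rightarrow> nat \<Rightarrow> 'v" where
  "vert_after tgt x as i = (if i = 0 then x else tgt (as ! (i - 1)))"

definition valid_path :: "('a \<Rightarrow> 'v) \<Rightarrow> ('a \<Rightarrow> 'v) \<Rightarrow> ('v,'a) path \<Rightarrow> bool" where
  "valid_path src tgt p = (\<forall>i < length (snd p). src (snd p ! i) = vert_after tgt (fst p) (snd p) i)"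

definition path_tgt :: "('a \<Rightarrow> 'v) \<Rightarrow> ('v,'a) path \<Rightarrow> 'v" where
  "path_tgt tgt p = vert_after tgt (fst p) (snd p) (length (snd p))"

definition quiver_connected :: "('a \<Rightarrow> 'v) \<Rightarrow> ('a \<Rightarrow> 'v) \<Rightarrow> bool" where
  "quiver_connected src tgt =
     (let E = {(src a, tgt a) | a. True} in \<forall>x y. (x, y) \<in> (E \<union> E\<inverse>)\<^sup>*)"

text \<open>Bypass: an arrow alpha and a path p different from alpha with the same source and target.\<close>
definition has_bypass :: "('a \<Rightarrow> 'v) \<Rightarrow> ('a \<Rightarrow> 'v) \<Rightarrow> bool" where
  "has_bypass src tgt = (\<exists>\<alpha> p. valid_path src tgt p \<and> p \<noteq> (src \<alpha>, [\<alpha>]) \<and>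
       fst p = src \<alpha> \<and> path_tgt tgt p = tgt \<alpha>)"

section \<open>The path algebra kQ\<close>

text \<open>Elements of kQ: finitely supported k-valued functions on (valid) paths.\<close>
definition pathalg :: "('a \<Rightarrow> 'v) \<Rightarrow> ('a \<Rightarrow> 'v) \<Rightarrow> (('v,'a) path \<Rightarrow> 'k::field) set" where
  "pathalg src tgt = {f. finite {p. f p \<noteq> 0} \<and> (\<forall>p. f p \<noteq> 0 \<longrightarrow> valid_path src tgt p)}"

definition pscale :: "'k::field \<Rightarrow> (('v,'a) path \<Rightarrow> 'k) \<Rightarrow> (('v,'a) path \<Rightarrow> 'k)" where
  "pscale c f = (\<lambda>p. c * f p)"

text \<open>Multiplication (concatenation of paths, zero if not composable).\<close>
definition pmul :: "('a \<Rightarrow> 'v) \<Rightarrow> (('v,'a) path \<Rightarrow> 'k::field) \<Rightarrow> (('v,'a) path \<Rightarrow> 'k)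
                   \<Rightarrow> (('v,'a) path \<Rightarrow> 'k)" where
  "pmul tgt f g = (\<lambda>(x, as). \<Sum>i \<in> {0..length as}.
       f (x, take i as) * g (vert_after tgt x as i, drop i as))"

text \<open>The basis element given by a path.\<close>
definition pel :: "('v,'a) path \<Rightarrow> (('v,'a) path \<Rightarrow> 'k::field)" where
  "pel p = (\<lambda>q. if q = p then 1 else 0)"

definition punit :: "(('v::finite,'a) path \<Rightarrow> 'k::field)" where
  "punit = (\<lambda>q. if snd q = [] then 1 else 0)"

definition two_sided_ideal :: "('a \<Rightarrow> 'v) \<Rightarrow> ('a \<Rightarrow> 'v) \<Rightarrow> (('v,'a) path \<Rightarrow> 'k::field) set \<Rightarrow> bool" where
  "two_sided_ideal src tgt I =
     (I \<subseteq> pathalg src tgt \<and> 0 \<in> I \<and> (\<forall>f\<in>I. \<forall>g\<in>I. f + g \<in> I) \<and>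
      (\<forall>c. \<forall>f\<in>I. pscale c f \<in> I) \<and>
      (\<forall>f\<in>pathalg src tgt. \<forall>g\<in>I. pmul tgt f g \<in> I \<and> pmul tgt g f \<in> I))"

text \<open>The n-th power of the arrow ideal: span of the paths of length at least n.\<close>
definition arrow_pow :: "('a \<Rightarrow> 'v) \<Rightarrow> ('a \<Rightarrow> 'v) \<Rightarrow> nat \<Rightarrow> (('v,'a) path \<Rightarrow> 'k::field) set" where
  "arrow_pow src tgt n = {f \<in> pathalg src tgt. \<forall>p. f p \<noteq> 0 \<longrightarrow> n \<le> length (snd p)}"

definition admissible :: "('a \<Rightarrow> 'v) \<Rightarrow> ('a \<Rightarrow> 'v) \<Rightarrow> (('v,'a) path \<Rightarrow> 'k::field) set \<Rightarrow> bool" where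
  "admissible src tgt I = (two_sided_ideal src tgt I \<and>
     (\<exists>m\<ge>2. arrow_pow src tgt m \<subseteq> I) \<and> I \<subseteq> arrow_pow src tgt 2)"

definition special_biserial ::
  "('a::finite \<Rightarrow> 'v) \<Rightarrow> ('a \<Rightarrow> 'v) \<Rightarrow> (('v,'a) path \<Rightarrow> 'k::field) set \<Rightarrow> bool" where
  "special_biserial src tgt I =
     (quiver_connected src tgt \<and> admissible src tgt I \<and>
      (\<forall>x. card {a. src a = x} \<le> 2 \<and> card {a. tgt a = x} \<le> 2) \<and>
      (\<forall>\<alpha>. card {\<beta>. src \<beta> = tgt \<alpha> \<and> pel (src \<alpha>, [\<alpha>, \<beta>]) \<notin> I} \<le> 1 \<and>
           card {\<gamma>. tgt \<gamma> = src \<alpha> \<and> pel (src \<gamma>, [\<gamma>, \<alpha>]) \<notin> I} \<le> 1))"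

section \<open>Abstract k-algebras\<close>

text \<open>A k-algebra: a ring with a k-vector space structure (scalar multiplication sc)
such that multiplication is k-bilinear.\<close>
definition kalg :: "('k::field \<Rightarrow> 'A::ring_1 \<Rightarrow> 'A) \<Rightarrow> bool" where
  "kalg sc = (vector_space sc \<and> (\<forall>c x y. sc c (x * y) = sc c x * y \<and> sc c (x * y) = x * sc c y))"

text \<open>A presents as kQ/I: pi is a surjective unital algebra map kQ -> A with kernel I.\<close>
definition presents ::
  "('a \<Rightarrow> 'v::finite) \<Rightarrow> ('a \<Rightarrow> 'v) \<Rightarrow> (('v,'a) path \<Rightarrow> 'k::field) set
     \<Rightarrow> ('k \<Rightarrow> 'A::ring_1 \<Rightarrow> 'A) \<Rightarrow> ((('v,'a) path \<Rightarrow> 'k) \<Rightarrow> 'A) \<Rightarrow> bool" where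
  "presents src tgt I sc \<pi> =
     ((\<forall>f\<in>pathalg src tgt. \<forall>g\<in>pathalg src tgt.
          \<pi> (f + g) = \<pi> f + \<pi> g \<and> \<pi> (pmul tgt f g) = \<pi> f * \<pi> g) \<and>
      (\<forall>c. \<forall>f\<in>pathalg src tgt. \<pi> (pscale c f) = sc c (\<pi> f)) \<and>
      \<pi> punit = 1 \<and> \<pi> ` pathalg src tgt = UNIV \<and>
      (\<forall>f\<in>pathalg src tgt. \<pi> f = 0 \<longleftrightarrow> f \<in> I))"

text \<open>A quotient algebra map q : A -> B with kernel S (so B is A/S).\<close>
definition quotient_map ::
  "('k::field \<Rightarrow> 'A::ring_1 \<Rightarrow> 'A) \<Rightarrow> ('k \<Rightarrow> 'B::ring_1 \<Rightarrow> 'B) \<Rightarrow> 'A set \<Rightarrow> ('A \<Rightarrow> 'B) \<Rightarrow> bool" where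
  "quotient_map sc sc' S q =
     ((\<forall>x y. q (x + y) = q x + q y \<and> q (x * y) = q x * q y) \<and>
      (\<forall>c x. q (sc c x) = sc' c (q x)) \<and> q 1 = 1 \<and> surj q \<and> (\<forall>x. q x = 0 \<longleftrightarrow> x \<in> S))"

section \<open>Derivations and the first Hochschild cohomology\<close>

definition Der :: "('k::field \<Rightarrow> 'A::ring_1 \<Rightarrow> 'A) \<Rightarrow> ('A \<Rightarrow> 'A) set" where
  "Der sc = {D. Vector_Spaces.linear sc sc D \<and> (\<forall>x y. D (x * y) = D x * y + x * D y)}"

definition Inn :: "('A::ring_1 \<Rightarrow> 'A) set" where
  "Inn = {(\<lambda>x. a * x - x * a) | a. True}"

text \<open>Scalar multiplication on the space of maps A -> A.\<close>
definition fscale :: "('k \<Rightarrow> 'A \<Rightarrow> 'A) \<Rightarrow> 'k \<Rightarrow> ('A \<Rightarrow> 'A) \<Rightarrow> ('A \<Rightarrow> 'A)" where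
  "fscale sc c f = (\<lambda>x. sc c (f x))"

definition commutator :: "('A::ring_1 \<Rightarrow> 'A) \<Rightarrow> ('A \<Rightarrow> 'A) \<Rightarrow> ('A \<Rightarrow> 'A)" where
  "commutator D1 D2 = (\<lambda>x. D1 (D2 x) - D2 (D1 x))"

section \<open>Right modules inside A, and the ideal S\<close>

text \<open>Right A-submodules of the regular module A_A (right ideals).\<close>
definition rsub :: "('k::field \<Rightarrow> 'A::ring_1 \<Rightarrow> 'A) \<Rightarrow> 'A set \<Rightarrow> bool" where
  "rsub sc M = (module.subspace sc M \<and> (\<forall>m\<in>M. \<forall>a. m * a \<in> M))"

definition uniserial :: "('k::field \<Rightarrow> 'A::ring_1 \<Rightarrow> 'A) \<Rightarrow> 'A set \<Rightarrow> bool" where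
  "uniserial sc M = (\<forall>N1 N2. rsub sc N1 \<and> N1 \<subseteq> M \<and> rsub sc N2 \<and> N2 \<subseteq> M \<longrightarrow>
                              N1 \<subseteq> N2 \<or> N2 \<subseteq> N1)"

definition simple_sub :: "('k::field \<Rightarrow> 'A::ring_1 \<Rightarrow> 'A) \<Rightarrow> 'A set \<Rightarrow> bool" where
  "simple_sub sc N = (rsub sc N \<and> N \<noteq> {0} \<and>
       (\<forall>N'. rsub sc N' \<and> N' \<subseteq> N \<longrightarrow> N' = {0} \<or> N' = N))"

text \<open>Socle: sum of the simple submodules.\<close>
definition socle :: "('k::field \<Rightarrow> 'A::ring_1 \<Rightarrow> 'A) \<Rightarrow> 'A set \<Rightarrow> 'A set" where
  "socle sc M = module.span sc (\<Union>{N. simple_sub sc N \<and> N \<subseteq> M})"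

text \<open>Injectivity of a submodule M of A_A, via Baer's criterion: every right A-linear map
from a right ideal J into M extends to A_A, i.e. is left multiplication by some m in M.\<close>
definition injective_mod :: "('k::field \<Rightarrow> 'A::ring_1 \<Rightarrow> 'A) \<Rightarrow> 'A set \<Rightarrow> bool" where
  "injective_mod sc M = (\<forall>J h. rsub sc J \<and> h ` J \<subseteq> M \<and>
       (\<forall>x\<in>J. \<forall>y\<in>J. h (x + y) = h x + h y) \<and> (\<forall>c. \<forall>x\<in>J. h (sc c x) = sc c (h x)) \<and>
       (\<forall>x\<in>J. \<forall>a. h (x * a) = h x * a)
     \<longrightarrow> (\<exists>m\<in>M. \<forall>j\<in>J. h j = m * j))"

text \<open>Indecomposable projective A-module at vertex x: e_x A.\<close>
definition proj_at :: "((('v,'a) path \<Rightarrow> 'k::field) \<Rightarrow> 'A::ring_1) \<Rightarrow> 'v \<Rightarrow> 'A set" where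
  "proj_at \<pi> x = (\<lambda>a. \<pi> (pel (x, [])) * a) ` UNIV"

text \<open>S: socle of the direct sum of the (pairwise non-isomorphic) indecomposable
non-uniserial projective-injective modules e_x A, viewed inside A = (+)_x e_x A.\<close>
definition S_ideal :: "('k::field \<Rightarrow> 'A::ring_1 \<Rightarrow> 'A) \<Rightarrow> ((('v,'a) path \<Rightarrow> 'k) \<Rightarrow> 'A) \<Rightarrow> 'A set" where
  "S_ideal sc \<pi> = module.span sc
     (\<Union>x \<in> {x. injective_mod sc (proj_at \<pi> x) \<and> \<not> uniserial sc (proj_at \<pi> x)}.
        socle sc (proj_at \<pi> x))"

end

theory Submission
  imports Defs
begin

text \<open>A nontrivial closed walk would yield a bypass, so \<open>Q\<close> is acyclic, and both \<open>e x * A * e x\<close> and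
  \<open>e x * A * e y\<close> for an arrow from \<open>x\<close> to \<open>y\<close> are one-dimensional. Hence, up to inner derivations, a
  derivation just multiplies each arrow \<open>a\<close> by a scalar \<open>t a\<close>, and a path by the sum of the scalars of
  its arrows. On \<open>A\<close> such scalars define a derivation if and only if the two paths of every binomial
  relation have the same total weight, while on \<open>A/S\<close>, whose relations are monomial, all scalars are
  allowed.

  The vertices \<open>x\<close> with a binomial relation between two paths \<open>p\<close>, \<open>q\<close> starting at \<open>x\<close> are exactly those
  for which \<open>e x * A\<close> is injective and not uniserial; the relation at such an \<open>x\<close> is unique up to a
  scalar and the socle of \<open>e x * A\<close> is spanned by the class of \<open>p\<close>. So \<open>dim S\<close> counts the conditions
  \<open>t p = t q\<close>. They are independent: the first arrow of \<open>p\<close> can only occur in a relation at a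
  vertex \<open>y\<close> from which \<open>x\<close> is reachable, and \<open>Q\<close> is acyclic.\<close>

section \<open>Walks in a quiver\<close>

text \<open>The shape of the relations comes from one remark: a nonzero path is determined by its
  first arrow and its length. As there are no closed paths, two distinct parallel nonzero paths
  \<open>p\<close>, \<open>q\<close> therefore differ in their first and in their last arrows. If
  they are proportional and an arrow prolonged \<open>p\<close> to a nonzero path, it would prolong
  \<open>q\<close> as well and have two predecessors with nonzero product. So all arrows annihilate
  the class of \<open>p\<close> on both sides, and every nonzero path from \<open>x\<close> is an
  initial piece of \<open>p\<close> or \<open>q\<close>. This gives the uniqueness of the relation,
  and pairing initial with final pieces exhibits \<open>e x * A\<close> as the dual of
  \<open>A * e y\<close>, whence its injectivity. Exactness at the right end is expressed by
  dimensions. The independence argument uses arrow weights 0 and 1 and the fact that no arrow occurs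
  twice in a path, so it is the same in every characteristic.\<close>

primrec walk :: "('a \<Rightarrow> 'v) \<Rightarrow> ('a \<Rightarrow> 'v) \<Rightarrow> 'v \<Rightarrow> 'a list \<Rightarrow> 'v \<Rightarrow> bool" where
  "walk src tgt x [] y \<longleftrightarrow> x = y"
| "walk src tgt x (a # as) y \<longleftrightarrow> src a = x \<and> walk src tgt (tgt a) as y"

lemma walk_append:
  "walk src tgt x (as @ bs) y \<longleftrightarrow> (\<exists>z. walk src tgt x as z \<and> walk src tgt z bs y)"
  by (induction as arbitrary: x) auto

lemma walk_end_unique: "walk src tgt x as y \<Longrightarrow> walk src tgt x as z \<Longrightarrow> y = z"
  by (induction as arbitrary: x) auto

lemma walk_start_unique:
  "walk src tgt x as y \<Longrightarrow> walk src tgt x' as y' \<Longrightarrow> as \<noteq> [] \<Longrightarrow> x = x'"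
  by (cases as) auto

text \<open>The bridge from index-based paths to a recursion on the list, in which paths can be cut
  and joined.\<close>

lemma valid_path_walk_iff:
  "valid_path src tgt (x, as) \<and> path_tgt tgt (x, as) = y \<longleftrightarrow> walk src tgt x as y"
proof (induction as arbitrary: x)
  case Nil
  then show ?case by (auto simp: valid_path_def path_tgt_def vert_after_def)
next
  case (Cons a as)
  have "valid_path src tgt (x, a # as) \<longleftrightarrow> src a = x \<and> valid_path src tgt (tgt a, as)"
    unfolding valid_path_def
    by (auto simp: vert_after_def nth_Cons' less_Suc_eq_0_disj split: if_splits)
  moreover have "path_tgt tgt (x, a # as) = path_tgt tgt (tgt a, as)"
    by (auto simp: path_tgt_def vert_after_def nth_Cons')
  ultimately show ?case using Cons.IH[of "tgt a"] by auto
qed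

lemma valid_path_iff_walk: "valid_path src tgt (x, as) \<longleftrightarrow> (\<exists>y. walk src tgt x as y)"
  using valid_path_walk_iff by metis

lemma path_tgt_walk: "walk src tgt x as y \<Longrightarrow> path_tgt tgt (x, as) = y"
  using valid_path_walk_iff by metis

text \<open>Of all cut points in the defining sum only the one after \<open>length as\<close> arrows
  can contribute.\<close>

lemma pmul_pel:
  assumes "walk src tgt x as y"
  shows "pmul tgt (pel (x, as)) (pel (y', bs)) =
    (if y = y' then pel (x, as @ bs) else (0 :: _ \<Rightarrow> 'k::field))"
proof (rule ext, clarify)
  fix z cs
  have eq: "pmul tgt (pel (x, as)) (pel (y', bs)) (z, cs) =
      (\<Sum>i\<in>{0..length cs}. if z = x \<and> take i cs = as \<and> vert_after tgt z cs i = y' \<and> drop i cs = bs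
         then (1::'k) else 0)"
    unfolding pmul_def pel_def by (auto intro!: sum.cong)
  have va: "vert_after tgt x (as @ bs) (length as) = y"
    using path_tgt_walk[OF assms]
    by (auto simp: path_tgt_def vert_after_def nth_append)
  have cnd: "(z = x \<and> take i cs = as \<and> vert_after tgt z cs i = y' \<and> drop i cs = bs) \<longleftrightarrow>
      i = length as \<and> z = x \<and> cs = as @ bs \<and> y = y'" if "i \<le> length cs" for i
  proof
    assume h: "z = x \<and> take i cs = as \<and> vert_after tgt z cs i = y' \<and> drop i cs = bs"
    then have "length as = i" using that by auto
    moreover have "cs = as @ bs" using h append_take_drop_id by metis
    ultimately show "i = length as \<and> z = x \<and> cs = as @ bs \<and> y = y'" using h va by auto
  qed (use va in auto)
  have "pmul tgt (pel (x, as)) (pel (y', bs)) (z, cs) =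
      (\<Sum>i\<in>{0..length cs}. if i = length as
         then (if z = x \<and> cs = as @ bs \<and> y = y' then (1::'k) else 0) else 0)"
    unfolding eq by (rule sum.cong) (use cnd in auto)
  also have "\<dots> = (if z = x \<and> cs = as @ bs \<and> y = y' then 1 else 0)"
    by (subst sum.delta) auto
  finally show "pmul tgt (pel (x, as)) (pel (y', bs)) (z, cs) =
      (if y = y' then pel (x, as @ bs) else (0 :: _ \<Rightarrow> 'k)) (z, cs)"
    by (auto simp: pel_def)
qed

text \<open>Coefficients are attached to indices and not to vectors because different walks may have
  the same residue class.\<close>

lemma (in module) span_image_sum:
  assumes "finite S" "u \<in> span (f ` S)"
  shows "\<exists>g. u = (\<Sum>i\<in>S. scale (g i) (f i))"
  using assms(2)
proof (induction rule: span_induct_alt)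
  case base
  show ?case by (rule exI[of _ "\<lambda>_. 0"]) simp
next
  case (step c x y)
  then obtain g i where g: "y = (\<Sum>i\<in>S. scale (g i) (f i))" and i: "i \<in> S" "x = f i" by auto
  have "(\<Sum>j\<in>S. scale (g j + (if j = i then c else 0)) (f j)) =
      y + (\<Sum>j\<in>S. if j = i then scale c (f j) else 0)"
    unfolding g sum.distrib[symmetric]
    by (rule sum.cong) (auto simp: scale_left_distrib)
  also have "\<dots> = scale c x + y" using i assms(1) by simp
  finally show ?case by metis
qed

section \<open>Quotients of path algebras without bypasses\<close>

text \<open>\<open>M x as\<close> stands for the residue class of the path \<open>(x, as)\<close>; it is unconstrained when \<open>as\<close> is
  not a walk from \<open>x\<close>. Since both \<open>A\<close> and \<open>A/S\<close> are instances, no ideal is mentioned.\<close>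

locale path_algebra_quotient = vector_space sc
  for sc :: "'k::field \<Rightarrow> 'A::ring_1 \<Rightarrow> 'A" +
  fixes src tgt :: "'a::finite \<Rightarrow> 'v::finite" and M :: "'v \<Rightarrow> 'a list \<Rightarrow> 'A"
  assumes scale_mult_left: "sc c u * v = sc c (u * v)"
    and scale_mult_right: "u * sc c v = sc c (u * v)"
    and no_bypass: "walk src tgt (src a) as (tgt a) \<Longrightarrow> as = [a]"
    and M_mult: "walk src tgt x as y \<Longrightarrow> walk src tgt y bs z \<Longrightarrow> M x as * M y bs = M x (as @ bs)"
    and M_vertex_orthogonal: "x \<noteq> y \<Longrightarrow> M x [] * M y [] = 0"
    and sum_M_vertex: "(\<Sum>x\<in>UNIV. M x []) = 1"
    and span_M: "span {M x as | x as y. walk src tgt x as y} = UNIV"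
    and M_vertex_nonzero: "M x [] \<noteq> 0"
    and M_arrow_nonzero: "M (src a) [a] \<noteq> 0"
begin

abbreviation wk where "wk \<equiv> walk src tgt"
abbreviation e where "e x \<equiv> M x []"
abbreviation ar where "ar a \<equiv> M (src a) [a]"

lemma wk_arrow: "wk (src a) [a] (tgt a)" by simp

text \<open>Appending its first arrow to a nontrivial closed walk would give a bypass.\<close>

lemma closed_walk_trivial: assumes "wk x as x" shows "as = []"
proof (cases as)
  case (Cons a bs)
  with assms have "wk (src a) (as @ [a]) (tgt a)" by (auto simp: walk_append)
  from no_bypass[OF this] Cons show ?thesis by simp
qed

text \<open>The surplus is a closed walk. This turns comparability of parallel walks, which is what
  the biserial conditions yield, into equality.\<close>

lemma parallel_prefix: "wk x as y \<Longrightarrow> wk x (as @ bs) y \<Longrightarrow> bs = []"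
  by (metis walk_append walk_end_unique closed_walk_trivial)

lemma parallel_suffix: "wk x bs y \<Longrightarrow> wk x (as @ bs) y \<Longrightarrow> as = []"
  by (cases "bs = []") (auto simp: walk_append dest: closed_walk_trivial walk_start_unique)

text \<open>A repeated arrow closes a walk. Besides bounding lengths, this makes the multiplicity of
  an arrow in a walk 0 or 1, so it cannot vanish modulo the characteristic.\<close>

lemma walk_distinct: "wk x as y \<Longrightarrow> distinct as"
proof (induction as arbitrary: x)
  case (Cons a as)
  have "a \<notin> set as"
  proof
    assume "a \<in> set as"
    then obtain us vs where as: "as = us @ a # vs" by (meson split_list)
    then have "wk x (a # us) x" using Cons.prems by (auto simp: walk_append)
    from closed_walk_trivial[OF this] show False by simp
  qed
  then show ?case using Cons by auto
qed simp

definition walks where "walks x y = {as. wk x as y}"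

lemma finite_walks [simp]: "finite (walks x y)"
  by (rule finite_subset[OF _ finite_subset_distinct[of UNIV]]) (auto simp: walks_def walk_distinct)

lemma e_M: "wk x as y \<Longrightarrow> e z * M x as = (if z = x then M x as else 0)"
  using M_mult[of x "[]" x as y] M_vertex_orthogonal[of z x]
  by (auto, metis mult.assoc mult_zero_left)

lemma M_e: "wk x as y \<Longrightarrow> M x as * e z = (if z = y then M x as else 0)"
  using M_mult[of x as y "[]" y] M_vertex_orthogonal[of y z]
  by (auto, metis mult.assoc mult_zero_right)

lemma e_idem [simp]: "e x * e x = e x" using e_M[of x "[]" x x] by simp

lemma M_mult_0: "wk x as y \<Longrightarrow> wk y' bs z \<Longrightarrow> y \<noteq> y' \<Longrightarrow> M x as * M y' bs = 0"
  using M_e[of x as y y'] e_M[of y' bs z y'] by (metis mult.assoc mult_zero_left)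

lemma M_append_0_left: "wk x (as @ bs) y \<Longrightarrow> M x as = 0 \<Longrightarrow> M x (as @ bs) = 0"
  by (metis M_mult walk_append mult_zero_left)

lemma subspace_UNIV_I: "subspace (Collect P) \<Longrightarrow> (\<And>x as y. wk x as y \<Longrightarrow> P (M x as)) \<Longrightarrow> P u"
  using span_induct[of u "{M x as | x as y. wk x as y}" P] span_M by auto

lemma corner_span: "e x * u * e y \<in> span (M x ` walks x y)"
proof (rule subspace_UNIV_I[of _ u])
  show "subspace {u. e x * u * e y \<in> span (M x ` walks x y)}"
    by (auto simp: subspace_def span_zero distrib_left distrib_right scale_mult_left
        scale_mult_right span_add span_scale)
next
  fix x' as y' assume w: "wk x' as y'"
  show "e x * M x' as * e y \<in> span (M x ` walks x y)"
  proof (cases "x = x' \<and> y = y'")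
    case True
    then show ?thesis using w by (simp add: e_M M_e span_base walks_def)
  next
    case False
    then show ?thesis using w e_M[OF w, of x] M_e[OF w, of y] by (auto simp: span_zero)
  qed
qed

lemma corner_sum: "\<exists>g. e x * u * e y = (\<Sum>as\<in>walks x y. sc (g as) (M x as))"
  by (rule span_image_sum[OF finite_walks corner_span])

lemma right_peirce: "u = (\<Sum>y\<in>UNIV. u * e y)"
  by (simp flip: sum_distrib_left add: sum_M_vertex)

text \<open>\<open>cf x as y u\<close> is the coefficient of \<open>M x as\<close> in \<open>e x * u * e y\<close>, which makes sense only if
  \<open>M x as\<close> spans \<open>e x * A * e y\<close>.\<close>

definition thin :: "'v \<Rightarrow> 'a list \<Rightarrow> 'v \<Rightarrow> bool" where
  "thin x as y \<longleftrightarrow> wk x as y \<and> M x as \<noteq> 0 \<and> (\<forall>bs\<in>walks x y. M x bs \<in> span {M x as})"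

definition cf :: "'v \<Rightarrow> 'a list \<Rightarrow> 'v \<Rightarrow> 'A \<Rightarrow> 'k" where
  "cf x as y u = (SOME c. e x * u * e y = sc c (M x as))"

lemma cf_eq: assumes "thin x as y" shows "e x * u * e y = sc (cf x as y u) (M x as)"
proof -
  have "span (M x ` walks x y) \<subseteq> span {M x as}"
    using assms by (intro span_minimal) (auto simp: thin_def)
  then have "e x * u * e y \<in> span {M x as}" using corner_span by blast
  then have "\<exists>c. e x * u * e y = sc c (M x as)" by (auto simp: span_singleton)
  then show ?thesis unfolding cf_def by (rule someI_ex)
qed

lemma cf_unique: assumes "thin x as y" "e x * u * e y = sc c (M x as)" shows "cf x as y u = c"
  using cf_eq[OF assms(1), of u] assms by (auto simp: thin_def)

lemma cf_add: "thin x as y \<Longrightarrow> cf x as y (u + v) = cf x as y u + cf x as y v"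
  by (rule cf_unique) (simp_all add: distrib_left distrib_right cf_eq scale_left_distrib)

lemma cf_diff: "thin x as y \<Longrightarrow> cf x as y (u - v) = cf x as y u - cf x as y v"
  by (rule cf_unique) (simp_all add: left_diff_distrib right_diff_distrib cf_eq scale_left_diff_distrib)

lemma cf_scale: "thin x as y \<Longrightarrow> cf x as y (sc c u) = c * cf x as y u"
  by (rule cf_unique) (simp_all add: scale_mult_left scale_mult_right cf_eq)

lemma cf_self: "thin x as y \<Longrightarrow> cf x as y (M x as) = 1"
  by (rule cf_unique) (auto simp: thin_def e_M M_e)

lemma thin_e: "thin x [] x"
  using M_vertex_nonzero by (auto simp: thin_def walks_def span_base dest!: closed_walk_trivial)

lemma thin_ar: "thin (src a) [a] (tgt a)"
  using M_arrow_nonzero by (auto simp: thin_def walks_def span_base dest!: no_bypass)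

end

section \<open>Derivations\<close>

definition inner :: "'A::ring_1 \<Rightarrow> 'A \<Rightarrow> 'A" where
  "inner c = (\<lambda>u. c * u - u * c)"

lemma Inn_eq_range: "Inn = range inner"
  by (auto simp: Inn_def inner_def)

abbreviation wt :: "('a \<Rightarrow> 'k::comm_monoid_add) \<Rightarrow> 'a list \<Rightarrow> 'k" where
  "wt t as \<equiv> sum_list (map t as)"

lemma vector_space_fscale: "vector_space sc \<Longrightarrow> vector_space (fscale sc)"
  unfolding vector_space_def fscale_def by (auto simp: fun_eq_iff)

context path_algebra_quotient
begin

lemma Der_iff: "D \<in> Der sc \<longleftrightarrow> (\<forall>u v. D (u + v) = D u + D v) \<and> (\<forall>c u. D (sc c u) = sc c (D u)) \<and>
    (\<forall>u v. D (u * v) = D u * v + u * D v)"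
  unfolding Der_def Vector_Spaces.linear_iff using vector_space_axioms by auto

lemma DerD:
  assumes "D \<in> Der sc"
  shows "D (u + v) = D u + D v" "D (sc c u) = sc c (D u)" "D (u * v) = D u * v + u * D v"
    "D 0 = 0" "D (u - v) = D u - D v"
proof -
  show a: "D (u + v) = D u + D v" "D (sc c u) = sc c (D u)" "D (u * v) = D u * v + u * D v" for u v c
    using assms by (auto simp: Der_iff)
  show "D 0 = 0" using a(1)[of 0 0] by simp
  show "D (u - v) = D u - D v" using a(1)[of "u - v" v] by (simp add: algebra_simps)
qed

lemma inner_Der: "inner c \<in> Der sc"
  by (auto simp: Der_iff inner_def algebra_simps scale_mult_left scale_mult_right scale_right_diff_distrib)

lemma Der_add: "D \<in> Der sc \<Longrightarrow> E \<in> Der sc \<Longrightarrow> D + E \<in> Der sc"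
  by (auto simp: Der_iff algebra_simps scale_right_distrib)

lemma Der_diff: "D \<in> Der sc \<Longrightarrow> E \<in> Der sc \<Longrightarrow> D - E \<in> Der sc"
  by (auto simp: Der_iff algebra_simps scale_right_diff_distrib)

lemma Der_fscale: "D \<in> Der sc \<Longrightarrow> fscale sc c D \<in> Der sc"
  by (auto simp: Der_iff fscale_def scale_right_distrib scale_mult_left scale_mult_right scale_left_commute)

lemma Der_eqI:
  assumes "D \<in> Der sc" "E \<in> Der sc" "\<And>x as y. wk x as y \<Longrightarrow> D (M x as) = E (M x as)"
  shows "D = E"
proof
  fix u
  show "D u = E u"
    by (rule subspace_UNIV_I[of "\<lambda>u. D u = E u"])
      (use assms in \<open>auto simp: subspace_def DerD\<close>)
qed

text \<open>The arrow scalars of \<open>Der_normal_form\<close>. Reading them off as coefficients of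
  \<open>D\<close> itself, before any inner derivation is subtracted, makes them linear in
  \<open>D\<close>.\<close>

definition tau :: "('A \<Rightarrow> 'A) \<Rightarrow> 'a \<Rightarrow> 'k" where
  "tau D a = cf (src a) [a] (tgt a) (D (ar a))"

lemma tau_add: "tau (D + E) a = tau D a + tau E a"
  by (simp add: tau_def cf_add[OF thin_ar])

lemma tau_diff: "tau (D - E) a = tau D a - tau E a"
  by (simp add: tau_def cf_diff[OF thin_ar])

lemma tau_fscale: "tau (fscale sc c D) a = c * tau D a"
  by (simp add: tau_def cf_scale[OF thin_ar] fscale_def)

lemma wt_tau_add: "wt (tau (D + E)) as = wt (tau D) as + wt (tau E) as"
  by (simp only: ext[OF tau_add] sum_list_addf)

lemma wt_tau_fscale: "wt (tau (fscale sc c D)) as = c * wt (tau D) as"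
  by (simp only: ext[OF tau_fscale] sum_list_const_mult)

lemma e_ar: "e (src a) * ar a = ar a" "ar a * e (tgt a) = ar a"
  using e_M[OF wk_arrow, of "src a" a] M_e[OF wk_arrow, of a "tgt a"] by auto

lemma tau_inner: "tau (inner c) a = cf (src a) [] (src a) c - cf (tgt a) [] (tgt a) c"
  unfolding tau_def
proof (rule cf_unique[OF thin_ar])
  have "e (src a) * inner c (ar a) * e (tgt a) =
      (e (src a) * c * e (src a)) * ar a - ar a * (e (tgt a) * c * e (tgt a))"
    unfolding inner_def by (simp add: algebra_simps e_ar flip: mult.assoc)
      (simp add: mult.assoc e_ar)
  also have "\<dots> = sc (cf (src a) [] (src a) c - cf (tgt a) [] (tgt a) c) (ar a)"
    by (simp add: cf_eq[OF thin_e] scale_mult_left scale_mult_right e_ar scale_left_diff_distrib)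
  finally show "e (src a) * inner c (ar a) * e (tgt a) =
     sc (cf (src a) [] (src a) c - cf (tgt a) [] (tgt a) c) (ar a)" .
qed

text \<open>The sum telescopes. Hence the difference of the weights of two parallel walks is an
  invariant of the cohomology class.\<close>

lemma wt_tau_inner: "wk x as y \<Longrightarrow> wt (tau (inner c)) as = cf x [] x c - cf y [] y c"
  by (induction as arbitrary: x) (auto simp: tau_inner)

text \<open>Subtracting the inner derivation of \<open>\<Sum>x. D (e x) * e x\<close> makes a derivation vanish on the
  vertices; it then acts diagonally on the arrows because parallel arrows are excluded.\<close>

lemma Der_normal_form:
  assumes D: "D \<in> Der sc"
  obtains c where "\<And>x as y. wk x as y \<Longrightarrow> D (M x as) = sc (wt (tau D) as) (M x as) + inner c (M x as)"
proof -
  define c where "c = (\<Sum>x\<in>UNIV. D (e x) * e x)"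
  define D' where "D' = D - inner c"
  have D0: "D' \<in> Der sc" unfolding D'_def by (intro Der_diff D inner_Der)
  have ce: "c * e y = D (e y) * e y" for y
  proof -
    have "c * e y = (\<Sum>x\<in>UNIV. D (e x) * (e x * e y))"
      by (simp add: c_def sum_distrib_right mult.assoc)
    also have "\<dots> = (\<Sum>x\<in>UNIV. if x = y then D (e y) * e y else 0)"
      by (rule sum.cong) (auto simp: M_vertex_orthogonal)
    finally show ?thesis by simp
  qed
  have ec: "e y * c = D (e y) * e y - D (e y)" for y
  proof -
    have "e y * c = (\<Sum>x\<in>UNIV. D (e y * e x) * e x - D (e y) * e x)"
      by (simp add: c_def sum_distrib_left DerD(3)[OF D] algebra_simps)
    also have "\<dots> = (\<Sum>x\<in>UNIV. D (e y * e x) * e x) - D (e y) * (\<Sum>x\<in>UNIV. e x)"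
      by (simp add: sum_subtractf sum_distrib_left)
    also have "(\<Sum>x\<in>UNIV. D (e y * e x) * e x) = (\<Sum>x\<in>UNIV. if x = y then D (e y) * e y else 0)"
      by (rule sum.cong) (auto simp: M_vertex_orthogonal DerD(4)[OF D])
    finally show ?thesis by (simp add: sum_M_vertex)
  qed
  have De: "D' (e y) = 0" for y
    by (simp add: D'_def inner_def ce ec)
  \<comment> \<open>A derivation satisfies \<open>e * D e * e = 0\<close> for an idempotent
    \<open>e\<close>. So \<open>c\<close> has no diagonal part, and subtracting
    \<open>inner c\<close> leaves \<open>tau\<close> unchanged.\<close>
  have ece: "e y * c * e y = 0" for y
  proof -
    have "D (e y) * e y = (D (e y) * e y + e y * D (e y)) * e y"
      using DerD(3)[OF D, of "e y" "e y"] by simp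
    then have "e y * D (e y) * e y = 0" by (simp add: distrib_right mult.assoc)
    then show ?thesis by (simp add: ce mult.assoc)
  qed
  have Dar: "D' (ar a) = sc (tau D a) (ar a)" for a
  proof -
    have "D' (ar a) = D' (e (src a) * ar a * e (tgt a))" by (simp add: e_ar)
    also have "\<dots> = e (src a) * D' (ar a) * e (tgt a)"
      by (simp only: DerD(3)[OF D0] De mult_zero_left mult_zero_right add_0_left add_0_right)
    also have "\<dots> = sc (tau D' a) (ar a)"
      unfolding tau_def by (rule cf_eq[OF thin_ar])
    also have "tau D' a = tau D a"
      using cf_unique[OF thin_e, of _ c 0] ece by (simp add: D'_def tau_diff tau_inner)
    finally show ?thesis .
  qed
  have DM: "D' (M x as) = sc (wt (tau D) as) (M x as)" if "wk x as y" for x as y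
    using that
  proof (induction as arbitrary: x)
    case (Cons a as)
    then have M: "M x (a # as) = ar a * M (tgt a) as" using M_mult[of x "[a]" "tgt a" as y] by auto
    show ?case using Cons
      by (simp only: M DerD(3)[OF D0] Dar) (simp add: scale_mult_left scale_mult_right scale_left_distrib)
  qed (simp add: De)
  have "D (M x as) = sc (wt (tau D) as) (M x as) + inner c (M x as)" if "wk x as y" for x as y
    using DM[OF that] by (simp add: D'_def algebra_simps)
  then show thesis by (rule that)
qed

text \<open>By \<open>ker\<close>, multiplying coefficients by weights respects all linear relations
  among the walks of a corner, so it descends to the algebra. The Leibniz rule holds on walks
  because weights add under concatenation.\<close>

lemma weight_derivation:
  assumes ker: "\<And>x y g. (\<Sum>as\<in>walks x y. sc (g as) (M x as)) = 0 \<Longrightarrow>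
      (\<Sum>as\<in>walks x y. sc (g as * wt t as) (M x as)) = 0"
  obtains D where "D \<in> Der sc" "\<And>x as y. wk x as y \<Longrightarrow> D (M x as) = sc (wt t as) (M x as)"
proof -
  define G where "G x y u = (SOME g. e x * u * e y = (\<Sum>as\<in>walks x y. sc (g as) (M x as)))" for x y u
  define d where "d x y u = (\<Sum>as\<in>walks x y. sc (G x y u as * wt t as) (M x as))" for x y u
  define D where "D u = (\<Sum>x\<in>UNIV. \<Sum>y\<in>UNIV. d x y u)" for u
  have G: "e x * u * e y = (\<Sum>as\<in>walks x y. sc (G x y u as) (M x as))" for x y u
    unfolding G_def by (rule someI_ex[OF corner_sum])
  \<comment> \<open>Independence of the coefficients chosen in \<open>G\<close>; linearity of
    \<open>d\<close> follows by inserting suitable \<open>g\<close>.\<close>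
  have d_eq: "d x y u = (\<Sum>as\<in>walks x y. sc (g as * wt t as) (M x as))"
    if "e x * u * e y = (\<Sum>as\<in>walks x y. sc (g as) (M x as))" for x y u g
  proof -
    have "(\<Sum>as\<in>walks x y. sc ((G x y u as - g as) * wt t as) (M x as)) = 0"
      by (rule ker) (use that G[of x u y] in \<open>simp add: scale_left_diff_distrib sum_subtractf\<close>)
    then show ?thesis
      by (simp add: d_def left_diff_distrib scale_left_diff_distrib sum_subtractf)
  qed
  have d_add: "d x y (u + v) = d x y u + d x y v" for x y u v
  proof -
    have "d x y (u + v) = (\<Sum>as\<in>walks x y. sc ((G x y u as + G x y v as) * wt t as) (M x as))"
      by (rule d_eq) (simp add: distrib_left distrib_right G scale_left_distrib sum.distrib)
    then show ?thesis by (simp add: d_def distrib_right scale_left_distrib sum.distrib)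
  qed
  have d_scale: "d x y (sc c u) = sc c (d x y u)" for x y u c
  proof -
    have "d x y (sc c u) = (\<Sum>as\<in>walks x y. sc ((c * G x y u as) * wt t as) (M x as))"
      by (rule d_eq) (simp add: scale_mult_left scale_mult_right G scale_sum_right)
    then show ?thesis by (simp add: d_def scale_sum_right mult.assoc)
  qed
  have D_add: "D (u + v) = D u + D v" for u v by (simp add: D_def d_add sum.distrib)
  have D_scale: "D (sc c u) = sc c (D u)" for c u by (simp add: D_def d_scale scale_sum_right)
  have D_zero: "D 0 = 0" using D_scale[of 0 0] by simp
  have DM: "D (M x as) = sc (wt t as) (M x as)" if w: "wk x as y" for x as y
  proof -
    have "d x' y' (M x as) = (if y' = y then if x' = x then sc (wt t as) (M x as) else 0 else 0)" for x' y'
    proof (cases "x' = x \<and> y' = y")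
      case True
      have "d x y (M x as) = (\<Sum>bs\<in>walks x y. sc ((if bs = as then 1 else 0) * wt t bs) (M x bs))"
      proof (rule d_eq)
        have "(\<Sum>bs\<in>walks x y. sc (if bs = as then 1 else 0) (M x bs)) =
          (\<Sum>bs\<in>walks x y. if bs = as then M x bs else 0)"
          by (rule sum.cong) auto
        then show "e x * M x as * e y = (\<Sum>bs\<in>walks x y. sc (if bs = as then 1 else 0) (M x bs))"
          using w by (simp add: e_M M_e) (simp add: walks_def)
      qed
      also have "\<dots> = (\<Sum>bs\<in>walks x y. if bs = as then sc (wt t as) (M x as) else 0)"
        by (rule sum.cong) auto
      also have "\<dots> = sc (wt t as) (M x as)"
        using w finite_walks[of x y] by (subst sum.delta) (auto simp: walks_def)
      finally show ?thesis using True by simp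
    next
      case False
      have "d x' y' (M x as) = (\<Sum>bs\<in>walks x' y'. sc (0 * wt t bs) (M x' bs))"
      proof (rule d_eq)
        show "e x' * M x as * e y' = (\<Sum>bs\<in>walks x' y'. sc 0 (M x' bs))"
          using False e_M[OF w, of x'] M_e[OF w, of y'] by auto
      qed
      then show ?thesis using False by auto
    qed
    then show ?thesis by (simp add: D_def)
  qed
  have mul: "D (M x as * M x' bs) = D (M x as) * M x' bs + M x as * D (M x' bs)"
    if w: "wk x as y" "wk x' bs z" for x as y x' bs z
  proof (cases "y = x'")
    case True
    then have m: "M x as * M x' bs = M x (as @ bs)" and "wk x (as @ bs) z"
      using M_mult w by (auto simp: walk_append)
    then have "D (M x as * M x' bs) = sc (wt t (as @ bs)) (M x as * M x' bs)" using DM by simp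
    then show ?thesis using w
      by (simp add: DM scale_mult_left scale_mult_right scale_left_distrib)
  next
    case False
    then show ?thesis using w M_mult_0[OF w]
      by (simp add: DM scale_mult_left scale_mult_right D_zero)
  qed
  have mul1: "D (M x as * v) = D (M x as) * v + M x as * D v" if w: "wk x as y" for x as y v
    by (rule subspace_UNIV_I[of "\<lambda>v. D (M x as * v) = D (M x as) * v + M x as * D v"])
      (use mul[OF w] in \<open>auto simp: subspace_def D_add D_scale D_zero scale_mult_right distrib_left
         scale_right_distrib\<close>)
  have "D (u * v) = D u * v + u * D v" for u v
    by (rule subspace_UNIV_I[of "\<lambda>u. D (u * v) = D u * v + u * D v"])
      (use mul1 in \<open>auto simp: subspace_def D_add D_scale D_zero scale_mult_left distrib_right
         scale_right_distrib\<close>)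
  then have "D \<in> Der sc" using D_add D_scale by (simp add: Der_iff)
  then show ?thesis using that DM by blast
qed

lemma tau_weight:
  assumes "\<And>x as y. wk x as y \<Longrightarrow> D (M x as) = sc (wt t as) (M x as)"
  shows "tau D = t"
proof
  fix a
  show "tau D a = t a" unfolding tau_def
    by (rule cf_unique[OF thin_ar])
      (use assms[OF wk_arrow, of a] in \<open>simp add: scale_mult_left scale_mult_right e_ar\<close>)
qed

end

text \<open>Needed for Baer's criterion, where a module map is given on a right ideal only, while
  \<open>binom_represent\<close> expects a functional on the whole algebra.\<close>

lemma (in vector_space) linear_extension_functional:
  fixes G :: "'b \<Rightarrow> 'a"
  assumes J: "subspace J"
    and add: "\<And>u v. u \<in> J \<Longrightarrow> v \<in> J \<Longrightarrow> G (u + v) = G u + G v"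
    and hom: "\<And>c u. u \<in> J \<Longrightarrow> G (scale c u) = c * G u"
  obtains g where "\<And>u v. g (u + v) = g u + g v" "\<And>c u. g (scale c u) = c * g u"
    "\<And>u. u \<in> J \<Longrightarrow> g u = G u"
proof -
  interpret k: vector_space "(*) :: 'a \<Rightarrow> 'a \<Rightarrow> 'a"
    by unfold_locales (auto simp: algebra_simps)
  interpret vector_space_pair scale "(*) :: 'a \<Rightarrow> 'a \<Rightarrow> 'a" ..
  obtain B where B: "B \<subseteq> J" "independent B" "J \<subseteq> span B"
    using maximal_independent_subset[of J] by metis
  from linear_independent_extend[OF B(2), of G] obtain g where
    g: "Vector_Spaces.linear scale (*) g" and gB: "\<forall>x\<in>B. g x = G x" by auto
  have ga: "g (u + v) = g u + g v" "g (scale c u) = c * g u" for u v c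
    using g by (auto simp: Vector_Spaces.linear_iff)
  have "u \<in> J \<and> g u = G u" if "u \<in> span B" for u
    using that
  proof (induction rule: span_induct_alt)
    case base
    have "G 0 = 0" "g 0 = 0" using hom[of 0 0] subspace_0[OF J] ga(2)[of 0 0] by auto
    then show ?case using subspace_0[OF J] by simp
  next
    case (step c x y)
    then have "x \<in> J" using B by auto
    then show ?case using step gB by (auto simp: add hom ga subspace_add[OF J] subspace_scale[OF J])
  qed
  with B(3) ga show thesis using that by blast
qed

section \<open>Nonzero walks and the characters at the vertices\<close>

context path_algebra_quotient
begin

abbreviation nz where "nz x as y \<equiv> wk x as y \<and> M x as \<noteq> 0"
abbreviation proj where "proj x \<equiv> range (\<lambda>u. e x * u)"

lemma proj_iff: "u \<in> proj x \<longleftrightarrow> e x * u = u"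
  by (auto simp flip: mult.assoc) (metis rangeI)

lemma nz_append_left: "M x (as @ bs) \<noteq> 0 \<Longrightarrow> wk x (as @ bs) y \<Longrightarrow> \<exists>z. nz x as z \<and> wk z bs y"
  by (metis M_mult walk_append mult_zero_left)

lemma nz_append_right: "M x (as @ bs) \<noteq> 0 \<Longrightarrow> wk x (as @ bs) y \<Longrightarrow> \<exists>z. wk x as z \<and> nz z bs y"
  by (metis M_mult walk_append mult_zero_right)

text \<open>No nontrivial walk is closed, so \<open>cf z [] z\<close> is the character of the
  algebra that belongs to the vertex \<open>z\<close>.\<close>

lemma cf_e_M: "wk x as y \<Longrightarrow> cf z [] z (M x as) = (if x = z \<and> as = [] then 1 else 0)"
proof (rule cf_unique[OF thin_e])
  assume w: "wk x as y"
  show "e z * M x as * e z = sc (if x = z \<and> as = [] then 1 else 0) (e z)"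
  proof (cases "as = []")
    case True
    then show ?thesis using w by (auto simp: M_vertex_orthogonal)
  next
    case False
    then have "\<not> (x = z \<and> y = z)" using w closed_walk_trivial by auto
    then show ?thesis using False w e_M[OF w, of z] M_e[OF w, of z] by auto
  qed
qed

text \<open>Every nontrivial walk from \<open>y\<close> starts with an arrow that kills the element,
  so only the character at \<open>y\<close> is left. A nonzero such element spans a simple
  submodule.\<close>

lemma right_killed:
  assumes w: "wk x as y" and kill: "\<And>c. src c = y \<Longrightarrow> M x (as @ [c]) = 0"
  shows "M x as * u = sc (cf y [] y u) (M x as)"
proof (rule subspace_UNIV_I[of "\<lambda>u. M x as * u = sc (cf y [] y u) (M x as)"])
  have "cf y [] y 0 = 0" by (rule cf_unique[OF thin_e]) simp
  then show "subspace {u. M x as * u = sc (cf y [] y u) (M x as)}"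
    by (auto simp: subspace_def distrib_left cf_add[OF thin_e] cf_scale[OF thin_e] scale_left_distrib
       scale_mult_right)
next
  fix x' bs y' assume w': "wk x' bs y'"
  show "M x as * M x' bs = sc (cf y [] y (M x' bs)) (M x as)"
  proof (cases "x' = y")
    case False
    then show ?thesis using M_mult_0[OF w w'] cf_e_M[OF w'] by auto
  next
    case x': True
    show ?thesis
    proof (cases bs)
      case Nil
      then show ?thesis using x' w w' cf_self[OF thin_e, of y] by (simp add: M_e)
    next
      case (Cons c cs)
      have "M x (as @ bs) = M x ((as @ [c]) @ cs)" using Cons by simp
      also have "\<dots> = 0"
        by (rule M_append_0_left[of _ _ _ y']) (use w w' x' Cons kill in \<open>auto simp: walk_append\<close>)
      finally show ?thesis using M_mult[OF w, of bs y'] w' x' Cons cf_e_M[OF w', of y] by simp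
    qed
  qed
qed

end

section \<open>Binomial relations of special biserial algebras\<close>

text \<open>The cardinality bounds are restated as coincidences among three or two arrows. Only
  \<open>A\<close> is made an instance; \<open>A/S\<close> enters as a
  \<open>path_algebra_quotient\<close>.\<close>

locale special_biserial_algebra = path_algebra_quotient sc src tgt M
  for sc :: "'k::field \<Rightarrow> 'A::ring_1 \<Rightarrow> 'A" and src tgt :: "'a::finite \<Rightarrow> 'v::finite"
    and M :: "'v \<Rightarrow> 'a list \<Rightarrow> 'A" +
  assumes out2: "src a = src b \<Longrightarrow> src b = src c \<Longrightarrow> a = b \<or> b = c \<or> a = c"
    and in2: "tgt a = tgt b \<Longrightarrow> tgt b = tgt c \<Longrightarrow> a = b \<or> b = c \<or> a = c"
    and next_unique: "src b = tgt a \<Longrightarrow> src c = tgt a \<Longrightarrow> M (src a) [a, b] \<noteq> 0 \<Longrightarrow> M (src a) [a, c] \<noteq> 0 \<Longrightarrow> b = c"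
    and prev_unique: "tgt b = src a \<Longrightarrow> tgt c = src a \<Longrightarrow> M (src b) [b, a] \<noteq> 0 \<Longrightarrow> M (src c) [c, a] \<noteq> 0 \<Longrightarrow> b = c"
begin

text \<open>By \<open>next_unique\<close> a nonzero walk has no choice after its first arrow, so two
  with the same first arrow agree until the shorter one ends.\<close>

lemma chain_right:
  "nz x (a # as) y \<Longrightarrow> nz x (a # bs) z \<Longrightarrow> \<exists>cs. as @ cs = bs \<or> bs @ cs = as"
proof (induction as arbitrary: x a bs)
  case (Cons b as)
  show ?case
  proof (cases bs)
    case bs: (Cons c ds)
    have x: "x = src a" using Cons.prems by auto
    have "M (src a) [a, b] \<noteq> 0" "src b = tgt a" "nz (tgt a) (b # as) y"
      using nz_append_left[of x "[a, b]" as y] nz_append_right[of x "[a]" "b # as" y] Cons.prems by auto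
    moreover have "M (src a) [a, c] \<noteq> 0" "src c = tgt a" "nz (tgt a) (c # ds) z"
      using nz_append_left[of x "[a, c]" ds z] nz_append_right[of x "[a]" "c # ds" z] Cons.prems bs by auto
    ultimately show ?thesis using Cons.IH[of "tgt a" b ds] next_unique[of b a c] bs by auto
  qed simp
qed auto

lemma parallel_head: "nz x (a # as) y \<Longrightarrow> nz x (a # bs) y \<Longrightarrow> as = bs"
  using chain_right[of x a as y bs y] parallel_prefix[of x "a # as" y] parallel_prefix[of x "a # bs" y]
  by (metis append_Cons append_Nil2)

lemma chain_left:
  "nz x (as @ [a]) y \<Longrightarrow> nz z (bs @ [a]) y \<Longrightarrow> \<exists>cs. cs @ as = bs \<or> cs @ bs = as"
proof (induction as arbitrary: y a bs rule: rev_induct)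
  case (snoc b as)
  show ?case
  proof (cases bs rule: rev_cases)
    case bs: (snoc ds c)
    have "M (src b) [b, a] \<noteq> 0" "tgt b = src a" "nz x (as @ [b]) (src a)"
      using nz_append_right[of x "as" "[b, a]" y] nz_append_left[of x "as @ [b]" "[a]" y] snoc.prems
      by (auto simp: walk_append)
    moreover have "M (src c) [c, a] \<noteq> 0" "tgt c = src a" "nz z (ds @ [c]) (src a)"
      using nz_append_right[of z "ds" "[c, a]" y] nz_append_left[of z "ds @ [c]" "[a]" y] snoc.prems bs
      by (auto simp: walk_append)
    ultimately show ?thesis using snoc.IH[of b "src a" ds] prev_unique[of b a c] bs by auto
  qed auto
qed auto

lemma parallel_last: "nz x (as @ [a]) y \<Longrightarrow> nz x (bs @ [a]) y \<Longrightarrow> as = bs"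
  using chain_left[of x as a y x bs] parallel_suffix[of x "as @ [a]" y] parallel_suffix[of x "bs @ [a]" y]
  by (metis append.assoc append_Nil)

text \<open>Both sides must survive in the algebra, which excludes differences of two zero paths;
  the scalar is then automatically nonzero.\<close>

definition binom where
  "binom x ps qs y \<longleftrightarrow> nz x ps y \<and> nz x qs y \<and> ps \<noteq> qs \<and> (\<exists>c. M x ps = sc c (M x qs))"

lemma binom_sym: assumes "binom x ps qs y" shows "binom x qs ps y"
proof -
  from assms obtain c where c: "M x ps = sc c (M x qs)" by (auto simp: binom_def)
  then have "c \<noteq> 0" using assms by (auto simp: binom_def)
  then have "M x qs = sc (inverse c) (M x ps)" using c by simp
  then show ?thesis using assms by (auto simp: binom_def)
qed

section \<open>Consequences of a single binomial relation\<close>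

context
  fixes x ps qs y
  assumes b: "binom x ps qs y"
begin

lemma binom_nz: "wk x ps y" "wk x qs y" "M x ps \<noteq> 0" "M x qs \<noteq> 0" "ps \<noteq> qs"
  using b by (auto simp: binom_def)

lemma binom_not_Nil: "ps \<noteq> []" "qs \<noteq> []"
  using binom_nz by (metis closed_walk_trivial walk.simps(1))+

lemma binom_hd: "hd ps \<noteq> hd qs"
  using binom_nz binom_not_Nil parallel_head[of x "hd ps" "tl ps" y "tl qs"]
  by (metis list.collapse)

lemma binom_last: "last ps \<noteq> last qs"
  using binom_nz binom_not_Nil parallel_last[of x "butlast ps" "last ps" y "butlast qs"]
  by (metis append_butlast_last_id)

lemma binom_src_hd: "src (hd ps) = x" "tgt (last ps) = y"
proof -
  show "src (hd ps) = x" using binom_nz(1) binom_not_Nil(1) by (cases ps) auto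
  show "tgt (last ps) = y" using binom_nz(1) binom_not_Nil(1)
    by (cases ps rule: rev_cases) (auto simp: walk_append)
qed

text \<open>Otherwise \<open>c\<close> would also prolong the proportional walk \<open>qs\<close>,
  and the distinct arrows \<open>last ps\<close> and \<open>last qs\<close> would contradict
  \<open>prev_unique\<close>.\<close>

lemma binom_kill_right: assumes "src c = y" shows "M x (ps @ [c]) = 0"
proof (rule ccontr)
  assume 1: "M x (ps @ [c]) \<noteq> 0"
  obtain c0 where c0: "M x ps = sc c0 (M x qs)" using b by (auto simp: binom_def)
  have w: "wk y [c] (tgt c)" using assms by simp
  have m: "M x ps * M y [c] = M x (ps @ [c])" "M x qs * M y [c] = M x (qs @ [c])"
    using M_mult w binom_nz by auto
  then have 2: "M x (qs @ [c]) \<noteq> 0" using 1 by (auto simp: c0 scale_mult_left)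
  have P: "M (src (last us)) [last us, c] \<noteq> 0 \<and> tgt (last us) = src c"
    if "M x (us @ [c]) \<noteq> 0" "wk x us y" "us \<noteq> []" for us
  proof -
    have us: "us = butlast us @ [last us]" using that by simp
    have ww: "wk x (us @ [c]) (tgt c)" using that w by (auto simp: walk_append)
    have "us @ [c] = butlast us @ [last us, c]" using us by simp
    then have "M x (butlast us @ [last us, c]) \<noteq> 0" "wk x (butlast us @ [last us, c]) (tgt c)"
      using that ww by metis+
    then show ?thesis using nz_append_right[of x "butlast us" "[last us, c]" "tgt c"] by auto
  qed
  have "last ps = last qs"
    using P[OF 1] P[OF 2] prev_unique[of "last ps" c "last qs"] binom_nz binom_not_Nil by auto
  then show False using binom_last by simp
qed

lemma binom_kill_left: assumes "tgt c = x" shows "M (src c) (c # ps) = 0"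
proof (rule ccontr)
  assume 1: "M (src c) (c # ps) \<noteq> 0"
  obtain c0 where c0: "M x ps = sc c0 (M x qs)" using b by (auto simp: binom_def)
  have w: "wk (src c) [c] x" using assms by simp
  have m: "ar c * M x ps = M (src c) (c # ps)" "ar c * M x qs = M (src c) (c # qs)"
    using M_mult[OF w] binom_nz by auto
  then have 2: "M (src c) (c # qs) \<noteq> 0" using 1 by (auto simp: c0 scale_mult_right)
  have P: "M (src c) [c, hd us] \<noteq> 0 \<and> src (hd us) = tgt c"
    if "M (src c) (c # us) \<noteq> 0" "wk x us y" "us \<noteq> []" for us
    using that assms nz_append_left[of "src c" "[c, hd us]" "tl us" y] by (cases us) auto
  have "hd ps = hd qs"
    using P[OF 1] P[OF 2] next_unique[of "hd ps" c "hd qs"] binom_nz binom_not_Nil by auto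
  then show False using binom_hd by simp
qed

text \<open>The two walks are comparable by \<open>chain_right\<close>, and \<open>as\<close> cannot
  run beyond \<open>ps\<close> because every arrow kills \<open>ps\<close>.\<close>

lemma binom_prefix_aux:
  assumes "nz x as z" "as \<noteq> []" "hd as = hd ps"
  shows "\<exists>bs. as @ bs = ps"
proof -
  have as: "as = hd as # tl as" "ps = hd ps # tl ps" using assms(2) binom_not_Nil by simp_all
  have "\<exists>cs. tl as @ cs = tl ps \<or> tl ps @ cs = tl as"
    by (rule chain_right[of x "hd as" _ z _ y]) (use as assms binom_nz in \<open>metis\<close>)+
  then obtain cs where cs: "tl as @ cs = tl ps \<or> tl ps @ cs = tl as" by blast
  show ?thesis
  proof (cases "tl as @ cs = tl ps")
    case True
    then show ?thesis using as assms(3) by (metis append_Cons)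
  next
    case False
    then have eq: "as = ps @ cs" using cs as assms(3) by (metis append_Cons)
    have "cs = []"
    proof (cases cs)
      case (Cons c ds)
      have "wk x ((ps @ [c]) @ ds) z" "M x ((ps @ [c]) @ ds) \<noteq> 0" using assms eq Cons by auto
      then have "M x (ps @ [c]) \<noteq> 0" "wk x (ps @ [c]) (tgt c)"
        using nz_append_left[of x "ps @ [c]" ds z] by (auto simp: walk_append)
      moreover have "src c = y" using calculation(2) binom_nz(1) walk_end_unique
        by (fastforce simp: walk_append)
      ultimately show ?thesis using binom_kill_right by simp
    qed
    then show ?thesis using eq by simp
  qed
qed

lemma binom_suffix_aux:
  assumes "nz z as y" "as \<noteq> []" "last as = last ps"
  shows "\<exists>bs. bs @ as = ps"
proof -
  have as: "as = butlast as @ [last as]" "ps = butlast ps @ [last ps]" using assms(2) binom_not_Nil by simp_all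
  have "\<exists>cs. cs @ butlast as = butlast ps \<or> cs @ butlast ps = butlast as"
    by (rule chain_left[of z _ "last as" y x]) (use as assms binom_nz in \<open>metis\<close>)+
  then obtain cs where cs: "cs @ butlast as = butlast ps \<or> cs @ butlast ps = butlast as" by blast
  show ?thesis
  proof (cases "cs @ butlast as = butlast ps")
    case True
    then show ?thesis using as assms(3) by (metis append.assoc)
  next
    case False
    then have eq: "as = cs @ ps" using cs as assms(3) by (metis append.assoc)
    have "cs = []"
    proof (cases cs rule: rev_cases)
      case (snoc ds c)
      have "wk z (ds @ (c # ps)) y" "M z (ds @ (c # ps)) \<noteq> 0" using assms eq snoc by auto
      then have "M (src c) (c # ps) \<noteq> 0" "wk (tgt c) ps y"
        using nz_append_right[of z "ds" "c # ps" y] by (auto simp: walk_append)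
      moreover have "tgt c = x" using calculation(2) binom_nz(1) binom_not_Nil walk_start_unique by metis
      ultimately show ?thesis using binom_kill_left by simp
    qed
    then show ?thesis using eq by simp
  qed
qed

end

context
  fixes x ps qs y
  assumes b: "binom x ps qs y"
begin

text \<open>By \<open>out2\<close> a nontrivial walk from \<open>x\<close> must start with the first
  arrow of \<open>ps\<close> or of \<open>qs\<close>.\<close>

lemma binom_from: assumes "nz x as z" shows "\<exists>bs. as @ bs = ps \<or> as @ bs = qs"
proof (cases "as = []")
  case False
  then have "src (hd as) = x" using assms by (cases as) auto
  then have "hd as = hd ps \<or> hd as = hd qs"
    using out2[of "hd as" "hd ps" "hd qs"] binom_hd[OF b] binom_src_hd[OF b] binom_src_hd[OF binom_sym[OF b]]
    by auto
  then show ?thesis using binom_prefix_aux[OF b assms False] binom_prefix_aux[OF binom_sym[OF b] assms False] by blast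
qed auto

lemma binom_to: assumes "nz z as y" shows "\<exists>bs. bs @ as = ps \<or> bs @ as = qs"
proof (cases "as = []")
  case False
  then have "tgt (last as) = y" using assms by (cases as rule: rev_cases) (auto simp: walk_append)
  then have "last as = last ps \<or> last as = last qs"
    using in2[of "last as" "last ps" "last qs"] binom_last[OF b] binom_src_hd[OF b] binom_src_hd[OF binom_sym[OF b]]
    by auto
  then show ?thesis using binom_suffix_aux[OF b assms False] binom_suffix_aux[OF binom_sym[OF b] assms False] by blast
qed auto

lemma binom_parallel: assumes "nz x as y" shows "as = ps \<or> as = qs"
  using binom_from[OF assms] assms binom_nz[OF b] parallel_prefix by (metis append_Nil2)

lemma binom_thin: "thin x ps y"
proof -
  obtain c where c: "M x qs = sc c (M x ps)" using binom_sym[OF b] by (auto simp: binom_def)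
  have "M x as \<in> span {M x ps}" if "wk x as y" for as
    using binom_parallel[of as] that c by (cases "M x as = 0") (auto simp: span_zero span_base span_scale)
  then show ?thesis using binom_nz[OF b] by (auto simp: thin_def walks_def)
qed

end

text \<open>A side of the second relation is an initial piece of a side of the first. It cannot be a
  proper one, since \<open>binom_kill_right\<close> forbids prolonging it.\<close>

lemma binom_unique_aux:
  assumes b: "binom x ps qs y" and b': "binom x ps' qs' y'"
  shows "y' = y \<and> (ps' = ps \<or> ps' = qs)"
proof -
  have "nz x ps' y'" using binom_nz[OF b'] by auto
  from binom_from[OF b this] obtain bs where bs: "ps' @ bs = ps \<or> ps' @ bs = qs" by blast
  have "bs = []"
  proof (cases bs)
    case (Cons c ds)
    have "wk x ((ps' @ [c]) @ ds) y" "M x ((ps' @ [c]) @ ds) \<noteq> 0" using bs Cons binom_nz[OF b] by auto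
    then have "M x (ps' @ [c]) \<noteq> 0" "wk x (ps' @ [c]) (tgt c)"
      using nz_append_left[of x "ps' @ [c]" ds y] by (auto simp: walk_append)
    moreover have "src c = y'" using calculation(2) binom_nz(1)[OF b'] walk_end_unique
      by (fastforce simp: walk_append)
    ultimately show ?thesis using binom_kill_right[OF b'] by simp
  qed simp
  then show ?thesis using bs binom_nz[OF b] binom_nz[OF b'] walk_end_unique by auto
qed

lemma binom_unique:
  assumes b: "binom x ps qs y" and b': "binom x ps' qs' y'"
  shows "y' = y" "(ps' = ps \<and> qs' = qs) \<or> (ps' = qs \<and> qs' = ps)"
  using binom_unique_aux[OF b b'] binom_unique_aux[OF b binom_sym[OF b']] binom_nz(5)[OF b'] by auto

end

context special_biserial_algebra
begin

section \<open>Non-uniserial projective-injective modules\<close>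

context
  fixes x ps qs y
  assumes b: "binom x ps qs y"
begin

text \<open>The proper cuts of the two walks, where the trivial cuts of \<open>qs\<close> are left out because
  \<open>M x qs\<close> is a multiple of \<open>M x ps\<close>. The prefixes form a basis of \<open>e x * A\<close>, the suffixes form a basis
  of \<open>A * e y\<close>, and the two are dual with respect to the coefficient of \<open>M x ps\<close>.\<close>

definition cuts where
  "cuts = {(v, w). v @ w = ps} \<union> {(v, w). v @ w = qs \<and> v \<noteq> [] \<and> w \<noteq> []}"

text \<open>A cut does not record the vertex where it is made; it is recovered as the end of the
  left half.\<close>

definition suf where "suf p = M (path_tgt tgt (x, fst p)) (snd p)"

definition cut_scalar where "cut_scalar p = cf x ps y (M x (fst p @ snd p))"

lemma finite_cuts: "finite cuts"
proof -
  have "finite {(v, w). v @ w = us}" for us :: "'a list"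
  proof (rule finite_subset)
    let ?L = "{v. set v \<subseteq> set us \<and> length v \<le> length us}"
    show "finite (?L \<times> ?L)" by (simp add: finite_lists_length_le)
  qed auto
  then have "finite ({(v, w). v @ w = ps} \<union> {(v, w). v @ w = qs})" by simp
  then show ?thesis by (rule rev_finite_subset) (auto simp: cuts_def)
qed

lemma cut_walk:
  assumes "p \<in> cuts"
  obtains z where "wk x (fst p) z" "wk z (snd p) y" "suf p = M z (snd p)"
proof -
  have "wk x (fst p @ snd p) y" using assms binom_nz[OF b] by (auto simp: cuts_def)
  then show ?thesis using that path_tgt_walk by (fastforce simp: walk_append suf_def)
qed

lemma cut_scalar: assumes "p \<in> cuts"
  shows "M x (fst p @ snd p) = sc (cut_scalar p) (M x ps)" "cut_scalar p \<noteq> 0"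
proof -
  have w: "nz x (fst p @ snd p) y" using assms binom_nz[OF b] by (auto simp: cuts_def)
  then show "M x (fst p @ snd p) = sc (cut_scalar p) (M x ps)"
    using cf_eq[OF binom_thin[OF b], of "M x (fst p @ snd p)"] by (simp add: cut_scalar_def e_M[of x _ y] M_e[of x _ y])
  then show "cut_scalar p \<noteq> 0" using w by auto
qed

text \<open>A nonzero product of a prefix and a suffix is a walk from \<open>x\<close> to
  \<open>y\<close>, hence \<open>ps\<close> or \<open>qs\<close>. As these differ in first and last
  arrow, halves of different walks cannot be glued, and halves of the same walk fit only at the same
  cut.\<close>

lemma cut_pairing:
  assumes p: "p \<in> cuts" and p': "p' \<in> cuts"
  shows "M x (fst p) * suf p' = (if p = p' then sc (cut_scalar p) (M x ps) else 0)"
proof -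
  obtain v w v' w' where pp: "p = (v, w)" "p' = (v', w')" by fastforce
  obtain z where z: "wk x v z" "wk z w y" "suf p = M z w" using cut_walk[OF p] pp by auto
  obtain z' where z': "wk x v' z'" "wk z' w' y" "suf p' = M z' w'" using cut_walk[OF p'] pp by auto
  have hl: "hd ps \<noteq> hd qs" "last ps \<noteq> last qs" "ps \<noteq> []" "qs \<noteq> []"
    using binom_hd[OF b] binom_last[OF b] binom_not_Nil[OF b] by auto
  have C: "v @ w = ps \<or> v @ w = qs \<and> v \<noteq> [] \<and> w \<noteq> []" "v' @ w' = ps \<or> v' @ w' = qs \<and> v' \<noteq> [] \<and> w' \<noteq> []"
    using p p' pp by (auto simp: cuts_def)
  show ?thesis
  proof (cases "M x v * M z' w' = 0")
    case True
    then have "p \<noteq> p'"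
      using cut_scalar[OF p] z z' pp M_mult[OF z(1,2)] binom_nz[OF b] walk_end_unique by force
    then show ?thesis using True pp(2) z' pp(1) by (metis fst_conv)
  next
    case False
    then have "z = z'" using M_mult_0[OF z(1) z'(2)] by blast
    then have m: "M x v * M z' w' = M x (v @ w')" and wk: "wk x (v @ w') y"
      using M_mult[OF z(1), of w' y] z z' by (auto simp: walk_append)
    then have "v @ w' = ps \<or> v @ w' = qs" using False binom_parallel[OF b, of "v @ w'"] by auto
    then have "p = p'"
      unfolding pp using C hl
      by (auto simp: append_eq_append_conv2 append_eq_Cons_conv Cons_eq_append_conv hd_append last_append split: if_splits)
    then show ?thesis using cut_scalar[OF p] pp m z' by simp
  qed
qed

lemma cuts_span_left: "e x * u \<in> span ((\<lambda>p. M x (fst p)) ` cuts)"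
proof (rule subspace_UNIV_I[of "\<lambda>u. e x * u \<in> span ((\<lambda>p. M x (fst p)) ` cuts)"])
  show "subspace {u. e x * u \<in> span ((\<lambda>p. M x (fst p)) ` cuts)}"
    by (auto simp: subspace_def span_zero distrib_left scale_mult_right span_add span_scale)
next
  fix x' as z assume w: "wk x' as z"
  show "e x * M x' as \<in> span ((\<lambda>p. M x (fst p)) ` cuts)"
  proof (cases "x = x' \<and> M x as \<noteq> 0")
    case True
    have I: "M x (fst p) \<in> span ((\<lambda>p. M x (fst p)) ` cuts)" if "p \<in> cuts" for p
      using that by (intro span_base imageI)
    obtain bs where "as @ bs = ps \<or> as @ bs = qs" using binom_from[OF b, of as z] True w by auto
    then consider "as @ bs = ps" | "as = []" | "as = qs" | "as @ bs = qs" "as \<noteq> []" "bs \<noteq> []"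
      by (cases "bs = []") auto
    then have "M x as \<in> span ((\<lambda>p. M x (fst p)) ` cuts)"
    proof cases
      case 3
      then show ?thesis using binom_sym[OF b] I[of "(ps, [])"]
        by (auto simp: binom_def cuts_def span_scale)
    qed (use I[of "(as, bs)"] I[of "([], ps)"] in \<open>auto simp: cuts_def\<close>)
    then show ?thesis using True e_M[OF w, of x] by auto
  next
    case False
    then show ?thesis using e_M[OF w, of x] by (auto simp: span_zero)
  qed
qed

lemma cuts_span_right: "u * e y \<in> span (suf ` cuts)"
proof (rule subspace_UNIV_I[of "\<lambda>u. u * e y \<in> span (suf ` cuts)"])
  show "subspace {u. u * e y \<in> span (suf ` cuts)}"
    by (auto simp: subspace_def span_zero distrib_right scale_mult_left span_add span_scale)
next
  fix x' as z assume w: "wk x' as z"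
  show "M x' as * e y \<in> span (suf ` cuts)"
  proof (cases "z = y \<and> M x' as \<noteq> 0")
    case True
    have I: "M z w \<in> span (suf ` cuts)" if "(v, w) \<in> cuts" "wk x v z" for v w z
    proof -
      have "suf (v, w) \<in> span (suf ` cuts)" using that by (intro span_base imageI)
      then show ?thesis using path_tgt_walk[OF that(2)] by (simp add: suf_def)
    qed
    have split: "wk x vs x'" if "wk x (vs @ as) y" "as \<noteq> []" for vs
      using that w walk_start_unique by (fastforce simp: walk_append)
    obtain bs where "bs @ as = ps \<or> bs @ as = qs" using binom_to[OF b, of x' as] True w by auto
    then consider "as = []" | "bs @ as = ps" "as \<noteq> []" | "as = qs" "as \<noteq> []" | "bs @ as = qs" "as \<noteq> []" "bs \<noteq> []"
      by (cases "bs = []") auto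
    then have "M x' as \<in> span (suf ` cuts)"
    proof cases
      case 1
      then show ?thesis using I[of ps "[]" y] binom_nz[OF b] w True by (auto simp: cuts_def)
    next
      case 3
      then have "x' = x" using w binom_nz[OF b] walk_start_unique by metis
      then show ?thesis using 3 binom_sym[OF b] I[of "[]" ps x]
        by (auto simp: binom_def cuts_def span_scale)
    qed (use I[of bs as x'] split[of bs] binom_nz[OF b] in \<open>auto simp: cuts_def\<close>)
    then show ?thesis using True M_e[OF w, of y] by auto
  next
    case False
    then show ?thesis using M_e[OF w, of y] by (auto simp: span_zero)
  qed
qed

text \<open>Multiplying by the suffix dual to a prefix with nonzero coefficient isolates that
  coefficient. Hence \<open>M x ps\<close> lies in every nonzero submodule of
  \<open>e x * A\<close>.\<close>

lemma binom_essential: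
  assumes "e x * u = u" "u \<noteq> 0"
  shows "\<exists>r. u * r = M x ps"
proof -
  obtain c where c: "u = (\<Sum>p\<in>cuts. sc (c p) (M x (fst p)))"
    using span_image_sum[OF finite_cuts cuts_span_left[of u]] assms by auto
  have "\<exists>p\<in>cuts. c p \<noteq> 0" using assms(2) c by (intro ccontr[of "\<exists>p\<in>cuts. c p \<noteq> 0"]) simp
  then obtain p where p: "p \<in> cuts" "c p \<noteq> 0" by blast
  have "u * suf p = (\<Sum>p'\<in>cuts. if p' = p then sc (c p * cut_scalar p) (M x ps) else 0)"
    unfolding c sum_distrib_right by (rule sum.cong) (auto simp: scale_mult_left cut_pairing p)
  also have "\<dots> = sc (c p * cut_scalar p) (M x ps)" using p finite_cuts by simp
  finally have u: "u * suf p = sc (c p * cut_scalar p) (M x ps)" .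
  have "u * sc (inverse (c p * cut_scalar p)) (suf p) = M x ps"
    unfolding scale_mult_right u scale_scale using p cut_scalar[OF p(1)] by (subst left_inverse) auto
  then show ?thesis by blast
qed

text \<open>This is the duality between \<open>e x * A\<close> and \<open>A * e y\<close>:
  \<open>m\<close> is the expansion of \<open>g\<close> in the dual basis, and dividing by
  \<open>cut_scalar\<close> normalizes the pairing.\<close>

lemma binom_represent:
  assumes add: "\<And>u v. g (u + v) = g u + g v" and hom: "\<And>c u. g (sc c u) = c * g u"
  obtains m where "e x * m = m" "\<And>j. j * e y = j \<Longrightarrow> m * j = sc (g j) (M x ps)"
proof
  let ?m = "\<Sum>p\<in>cuts. sc (g (suf p) / cut_scalar p) (M x (fst p))"
  have "e x * M x (fst p) = M x (fst p)" if "p \<in> cuts" for p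
    using cut_walk[OF that] e_M[of x "fst p"] by metis
  then show "e x * ?m = ?m" by (simp add: sum_distrib_left scale_mult_right)
  have m: "?m * suf p = sc (g (suf p)) (M x ps)" if p: "p \<in> cuts" for p
  proof -
    have "?m * suf p = (\<Sum>p'\<in>cuts. if p' = p then sc (g (suf p)) (M x ps) else 0)"
      unfolding sum_distrib_right
      by (rule sum.cong) (auto simp: scale_mult_left cut_pairing p cut_scalar)
    then show ?thesis using p finite_cuts by simp
  qed
  fix j assume j: "j * e y = j"
  have "j \<in> span (suf ` cuts)" using cuts_span_right[of j] j by simp
  then show "?m * j = sc (g j) (M x ps)"
  proof (induction rule: span_induct)
    case base
    have "g 0 = 0" using hom[of 0 0] by simp
    then show ?case by (auto simp: subspace_def distrib_left add hom scale_left_distrib scale_mult_right)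
  qed (use m in auto)
qed

text \<open>Baer's criterion: composing \<open>h\<close> with the coefficient of \<open>M x ps\<close> gives a functional that is
  represented by left multiplication with some \<open>m\<close>; then \<open>h j - m * j\<close> generates no nonzero
  multiple of \<open>M x ps\<close>, so it vanishes.\<close>

lemma binom_injective: "injective_mod sc (proj x)"
  unfolding injective_mod_def
proof (intro allI impI, elim conjE)
  fix J h
  assume J: "rsub sc J" and hJ: "h ` J \<subseteq> proj x"
    and hadd: "\<forall>u\<in>J. \<forall>v\<in>J. h (u + v) = h u + h v"
    and hsc: "\<forall>c. \<forall>u\<in>J. h (sc c u) = sc c (h u)" and hmul: "\<forall>u\<in>J. \<forall>a. h (u * a) = h u * a"
  have sJ: "subspace J" and Jm: "\<And>u a. u \<in> J \<Longrightarrow> u * a \<in> J" using J by (auto simp: rsub_def)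
  have eh: "e x * h j = h j" if "j \<in> J" for j using hJ that proj_iff by blast
  note th = binom_thin[OF b]
  obtain g where ga: "\<And>u v. g (u + v) = g u + g v" and gs: "\<And>c u. g (sc c u) = c * g u"
    and gJ: "\<And>u. u \<in> J \<Longrightarrow> g u = cf x ps y (h u)"
    by (rule linear_extension_functional[OF sJ, of "\<lambda>u. cf x ps y (h u)"])
      (use hadd hsc in \<open>auto simp: cf_add[OF th] cf_scale[OF th]\<close>)
  obtain m where m: "e x * m = m" "\<And>j. j * e y = j \<Longrightarrow> m * j = sc (g j) (M x ps)"
    using binom_represent[OF ga gs] by metis
  have "h j = m * j" if j: "j \<in> J" for j
  proof (rule ccontr)
    assume "h j \<noteq> m * j"
    moreover have "e x * (h j - m * j) = h j - m * j"
      using m(1) eh[OF j] by (simp add: right_diff_distrib flip: mult.assoc)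
    ultimately obtain r where r: "(h j - m * j) * r = M x ps" using binom_essential[of "h j - m * j"] by auto
    \<comment> \<open>The factor \<open>e y\<close> moves the argument into \<open>A * e y\<close>,
      where \<open>m\<close> represents \<open>g\<close>; it does not change
      \<open>M x ps\<close>.\<close>
    define i where "i = j * r * e y"
    have i: "i \<in> J" using Jm j by (simp add: i_def)
    have ie: "i * e y = i" by (simp add: i_def mult.assoc)
    have "h i = h i * e y" using hmul i ie by metis
    then have "h i = e x * h i * e y" using eh[OF i] by simp
    also have "\<dots> = sc (g i) (M x ps)" using cf_eq[OF th, of "h i"] gJ[OF i] by simp
    finally have hi: "h i = m * i" using m(2)[OF ie] by simp
    have "M x ps = (h j - m * j) * r * e y"
      using r M_e[OF binom_nz(1)[OF b], of y] by simp
    also have "\<dots> = h i - m * i"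
      using hmul j Jm by (simp add: i_def left_diff_distrib mult.assoc)
    finally show False using hi binom_nz[OF b] by simp
  qed
  then show "\<exists>m\<in>proj x. \<forall>j\<in>J. h j = m * j" using m(1) proj_iff by blast
qed

lemma binom_right_killed: "M x ps * u = sc (cf y [] y u) (M x ps)"
  by (rule right_killed) (use binom_nz[OF b] binom_kill_right[OF b] in auto)

lemma rsub_socle_line: "rsub sc (span {M x ps})"
proof -
  have "m * a \<in> span {M x ps}" if "m \<in> span {M x ps}" for m a
    using that by (auto simp: span_singleton scale_mult_left binom_right_killed)
  then show ?thesis by (auto simp: rsub_def subspace_span)
qed

lemma socle_line_minimal:
  assumes "rsub sc N" "N \<subseteq> proj x" "N \<noteq> {0}"
  shows "span {M x ps} \<subseteq> N"
proof -
  have sN: "subspace N" using assms by (auto simp: rsub_def)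
  then obtain u where u: "u \<in> N" "u \<noteq> 0" using assms(3) subspace_0 by blast
  moreover have "e x * u = u" using u assms(2) proj_iff by blast
  ultimately obtain r where "u * r = M x ps" using binom_essential by blast
  then have "M x ps \<in> N" using u assms(1) by (metis rsub_def)
  then show ?thesis by (intro span_minimal sN) auto
qed

lemma socle_line_proj: "span {M x ps} \<subseteq> proj x"
  using binom_nz[OF b] by (auto simp: span_singleton proj_iff scale_mult_right e_M)

lemma binom_socle: "socle sc (proj x) = span {M x ps}"
proof -
  have ne: "span {M x ps} \<noteq> {0}" using binom_nz[OF b] span_base[of "M x ps" "{M x ps}"] by auto
  have "{N. simple_sub sc N \<and> N \<subseteq> proj x} = {span {M x ps}}"
  proof (intro equalityI subsetI)
    fix N assume "N \<in> {N. simple_sub sc N \<and> N \<subseteq> proj x}"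
    then have N: "simple_sub sc N" "N \<subseteq> proj x" by auto
    then have "span {M x ps} \<subseteq> N" by (intro socle_line_minimal) (auto simp: simple_sub_def)
    then show "N \<in> {span {M x ps}}" using N rsub_socle_line ne by (auto simp: simple_sub_def)
  next
    fix N assume "N \<in> {span {M x ps}}"
    then have N: "N = span {M x ps}" by simp
    have "N' = {0} \<or> N' = N" if "rsub sc N'" "N' \<subseteq> N" for N'
      using socle_line_minimal[of N'] socle_line_proj that N by auto
    then show "N \<in> {N. simple_sub sc N \<and> N \<subseteq> proj x}"
      using rsub_socle_line ne socle_line_proj N by (simp add: simple_sub_def)
  qed
  then show ?thesis by (simp add: socle_def span_span)
qed

end

section \<open>Uniserial projectives, and injectivity without a binomial relation\<close>

lemma rsub_principal: "rsub sc (range (\<lambda>u. v * u))"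
proof -
  have "subspace (range (\<lambda>u. v * u))"
    unfolding subspace_def
  proof (intro conjI ballI allI)
    show "0 \<in> range (\<lambda>u. v * u)" by (metis mult_zero_right rangeI)
  qed (auto simp flip: distrib_left scale_mult_right)
  then show ?thesis by (auto simp: rsub_def mult.assoc)
qed

text \<open>A walk parallel to \<open>a\<close> that starts with \<open>b\<close> would be a bypass,
  so \<open>ar b * A\<close> has no component from \<open>src a\<close> to
  \<open>tgt a\<close>.\<close>

lemma arrow_not_in_principal:
  assumes "src a = src b" "a \<noteq> b"
  shows "ar a \<notin> range (\<lambda>u. ar b * u)"
proof
  assume "ar a \<in> range (\<lambda>u. ar b * u)"
  then obtain u where u: "ar a = ar b * u" by auto
  have "ar b * v * e (tgt a) = 0" for v
  proof (rule subspace_UNIV_I[of "\<lambda>v. ar b * v * e (tgt a) = 0"])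
    show "subspace {v. ar b * v * e (tgt a) = 0}"
      by (auto simp: subspace_def distrib_left distrib_right scale_mult_left scale_mult_right)
  next
    fix z as z' assume w: "wk z as z'"
    show "ar b * M z as * e (tgt a) = 0"
    proof (cases "z = tgt b \<and> z' = tgt a")
      case True
      then have "wk (src a) (b # as) (tgt a)" using w assms by auto
      from no_bypass[OF this] show ?thesis using assms by auto
    next
      case False
      then show ?thesis using M_mult_0[OF wk_arrow w] M_e[OF w, of "tgt a"] by (auto simp: mult.assoc)
    qed
  qed
  then have "ar a * e (tgt a) = 0" using u by simp
  then show False using M_arrow_nonzero by (simp add: e_ar)
qed

lemma not_uniserial:
  assumes "src a = x" "src b = x" "a \<noteq> b"
  shows "\<not> uniserial sc (proj x)"
proof
  assume "uniserial sc (proj x)"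
  then have "N1 \<subseteq> N2 \<or> N2 \<subseteq> N1" if "rsub sc N1" "N1 \<subseteq> proj x" "rsub sc N2" "N2 \<subseteq> proj x" for N1 N2
    using that unfolding uniserial_def by blast
  moreover have "range (\<lambda>u. ar c * u) \<subseteq> proj x" if "src c = x" for c
    using that e_ar(1)[of c] by (auto simp: proj_iff simp flip: mult.assoc)
  ultimately have "range (\<lambda>u. ar a * u) \<subseteq> range (\<lambda>u. ar b * u) \<or> range (\<lambda>u. ar b * u) \<subseteq> range (\<lambda>u. ar a * u)"
    using rsub_principal assms by simp
  moreover have "ar c \<in> range (\<lambda>u. ar c * u)" for c by (metis mult.right_neutral rangeI)
  ultimately have "ar a \<in> range (\<lambda>u. ar b * u) \<or> ar b \<in> range (\<lambda>u. ar a * u)" by blast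
  then show False using arrow_not_in_principal assms by metis
qed

text \<open>The nonzero walks from \<open>x\<close> form a chain, and each corner contains at most
  one of them. So a submodule is spanned by the walks it contains, and with a walk it contains all
  prolongations.\<close>

lemma uniserial_of_single_arrow:
  assumes one: "\<And>a b. src a = x \<Longrightarrow> src b = x \<Longrightarrow> a = b"
  shows "uniserial sc (proj x)"
proof -
  have cmp: "\<exists>cs. as @ cs = bs \<or> bs @ cs = as" if "nz x as y" "nz x bs z" for as bs y z
    using that one[of "hd as" "hd bs"] chain_right[of x "hd as" "tl as" y "tl bs" z]
    by (cases as; cases bs) auto
  have line: "\<exists>c as. nz x as y \<and> u * e y = sc c (M x as)" if u: "e x * u = u" "u * e y \<noteq> 0" for u y
  proof -
    obtain g where g: "u * e y = (\<Sum>as\<in>walks x y. sc (g as) (M x as))" using corner_sum[of x u y] u by auto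
    have "\<exists>as\<in>walks x y. sc (g as) (M x as) \<noteq> 0"
      using u(2) sum.neutral[of "walks x y" "\<lambda>as. sc (g as) (M x as)"] unfolding g by blast
    then obtain as where as: "as \<in> walks x y" "sc (g as) (M x as) \<noteq> 0" by blast
    have "bs = as" if "nz x bs y" for bs
      using cmp[OF that, of as y] as that parallel_prefix by (force simp: walks_def)
    then have "u * e y = (\<Sum>bs\<in>walks x y. if bs = as then sc (g as) (M x as) else 0)"
      unfolding g by (intro sum.cong) (auto simp: walks_def)
    then have "u * e y = sc (g as) (M x as)" using as by simp
    then show ?thesis using as by (auto simp: walks_def)
  qed
  show ?thesis
    unfolding uniserial_def
  proof (intro allI impI, elim conjE)
    fix N1 N2
    assume N: "rsub sc N1" "N1 \<subseteq> proj x" "rsub sc N2" "N2 \<subseteq> proj x"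
    have component: "\<exists>y as. nz x as y \<and> M x as \<in> N \<and> M x as \<notin> N'"
      if "rsub sc N" "rsub sc N'" "N \<subseteq> proj x" "u \<in> N" "u \<notin> N'" for N N' u
    proof -
      have sN: "subspace N" "subspace N'" using that by (auto simp: rsub_def)
      have "\<exists>y. u * e y \<notin> N'"
        using right_peirce[of u] subspace_sum[OF sN(2), of UNIV "\<lambda>y. u * e y"] that by metis
      then obtain y where y: "u * e y \<notin> N'" by blast
      have uN: "u * e y \<in> N" using that by (auto simp: rsub_def)
      have "e x * u = u" using that proj_iff by blast
      moreover have "u * e y \<noteq> 0" using y subspace_0[OF sN(2)] by auto
      ultimately obtain c as where c: "nz x as y" "u * e y = sc c (M x as)" using line by blast
      have "c \<noteq> 0" using c y subspace_0[OF sN(2)] by auto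
      then have "M x as = sc (inverse c) (u * e y)" using c by simp
      then have "M x as \<in> N" using uN subspace_scale[OF sN(1)] by simp
      moreover have "M x as \<notin> N'" using y c subspace_scale[OF sN(2)] by auto
      ultimately show ?thesis using c by blast
    qed
    show "N1 \<subseteq> N2 \<or> N2 \<subseteq> N1"
    proof (rule ccontr)
      assume "\<not> ?thesis"
      then obtain u v where "u \<in> N1" "u \<notin> N2" "v \<in> N2" "v \<notin> N1" by blast
      then obtain y as z bs where 1: "nz x as y" "M x as \<in> N1" "M x as \<notin> N2"
        and 2: "nz x bs z" "M x bs \<in> N2" "M x bs \<notin> N1"
        using component[of N1 N2 u] component[of N2 N1 v] N by blast
      have ext: "M x (as @ cs) \<in> N'" if "rsub sc N'" "M x as \<in> N'" "nz x as y" "wk x (as @ cs) z" for N' as cs y z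
      proof -
        have "wk y cs z" using that walk_end_unique by (fastforce simp: walk_append)
        then have "M x (as @ cs) = M x as * M y cs" using M_mult that by metis
        then show ?thesis using that by (auto simp: rsub_def)
      qed
      obtain cs where "as @ cs = bs \<or> bs @ cs = as" using cmp[OF 1(1) 2(1)] by blast
      then show False using ext[OF N(1) 1(2) 1(1), of cs z] ext[OF N(3) 2(2) 2(1), of cs y] 1 2 by auto
    qed
  qed
qed

text \<open>Walks have no repeated arrows, so a longest nonzero walk starting with \<open>a\<close>
  exists.\<close>

lemma maximal_walk:
  obtains as y where "nz (src a) (a # as) y" "\<And>c. src c = y \<Longrightarrow> M (src a) (a # as @ [c]) = 0"
proof -
  let ?P = "\<lambda>as. \<exists>y. nz (src a) (a # as) y"
  have "?P []" using M_arrow_nonzero by auto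
  moreover have "length as < card (UNIV :: 'a set)" if "?P as" for as
  proof -
    have "distinct (a # as)" using that walk_distinct by blast
    then have "length (a # as) \<le> card (UNIV :: 'a set)"
      using card_mono[of UNIV "set (a # as)"] distinct_card[of "a # as"] by simp
    then show ?thesis by simp
  qed
  ultimately obtain as where as: "?P as" "\<And>bs. ?P bs \<Longrightarrow> length bs \<le> length as"
    using ex_has_greatest_nat[of ?P "[]" length "card (UNIV :: 'a set)"] by (metis less_imp_le)
  then obtain y where y: "nz (src a) (a # as) y" by blast
  have "M (src a) (a # as @ [c]) = 0" if "src c = y" for c
  proof (rule ccontr)
    assume "M (src a) (a # as @ [c]) \<noteq> 0"
    moreover have "wk (src a) (a # as @ [c]) (tgt c)" using y that by (auto simp: walk_append)
    ultimately have "length (as @ [c]) \<le> length as" by (intro as(2)) blast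
    then show False by simp
  qed
  with y show ?thesis using that by blast
qed

text \<open>If the two maximal walks out of \<open>x\<close> are linearly independent, the projection of their
  span onto one of them along the other is right linear but is not a left multiplication.\<close>

lemma binom_of_injective:
  assumes ab: "src a = x" "src b = x" "a \<noteq> b" and inj: "injective_mod sc (proj x)"
  shows "\<exists>ps qs y. binom x ps qs y"
proof (rule ccontr)
  assume nob: "\<not> ?thesis"
  obtain as y where p: "nz x (a # as) y" "\<And>c. src c = y \<Longrightarrow> M x (a # as @ [c]) = 0"
    using maximal_walk[of a] ab by metis
  obtain bs z where q: "nz x (b # bs) z" "\<And>c. src c = z \<Longrightarrow> M x (b # bs @ [c]) = 0"
    using maximal_walk[of b] ab by metis
  define P Q where "P = M x (a # as)" and "Q = M x (b # bs)"
  have Pk: "P * u = sc (cf y [] y u) P" for u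
    unfolding P_def by (rule right_killed) (use p in auto)
  have Qk: "Q * u = sc (cf z [] z u) Q" for u
    unfolding Q_def by (rule right_killed) (use q in auto)
  have eP: "e x * P = P" and eQ: "e x * Q = Q"
    using e_M[OF conjunct1[OF p(1)], of x] e_M[OF conjunct1[OF q(1)], of x] by (auto simp: P_def Q_def)
  have PQ: "P \<noteq> 0" "Q \<noteq> 0" using p q by (auto simp: P_def Q_def)
  \<comment> \<open>Walks with different ends are separated by \<open>e y\<close>; for a common end,
    a dependence would be a binomial relation.\<close>
  have indep0: "s = 0" if st: "sc s P + sc t Q = 0" for s t
  proof (rule ccontr)
    assume s: "s \<noteq> 0"
    have Pey: "P * e y = P" using M_e[OF conjunct1[OF p(1)], of y] by (simp add: P_def)
    show False
    proof (cases "y = z")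
      case True
      have "sc s P = sc (- t) Q" using st by (simp add: add_eq_0_iff2)
      then have "P = sc (- t / s) Q" using s by (metis divide_inverse_commute right_inverse scale_one scale_scale mult.commute)
      then have "\<exists>c. P = sc c Q" by blast
      then have "binom x (a # as) (b # bs) y" using p q True ab(3) unfolding binom_def P_def Q_def by auto
      then show False using nob by blast
    next
      case False
      have "Q * e y = 0" using M_e[of x "b # bs" z y] q False by (simp add: Q_def)
      then have "(sc s P + sc t Q) * e y = sc s P" using Pey by (simp add: distrib_right scale_mult_left)
      then show False using st s PQ by auto
    qed
  qed
  have indep: "s = s' \<and> t = t'" if "sc s P + sc t Q = sc s' P + sc t' Q" for s t s' t'
  proof -
    have "sc (s - s') P + sc (t - t') Q = 0" using that by (simp add: scale_left_diff_distrib algebra_simps)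
    from indep0[OF this] have "s = s'" by simp
    then show ?thesis using that PQ by simp
  qed
  define J where "J = {sc s P + sc t Q | s t. True}"
  define h where "h u = sc (THE s. \<exists>t. u = sc s P + sc t Q) P" for u
  have h: "h (sc s P + sc t Q) = sc s P" for s t
  proof -
    have "(THE s'. \<exists>t'. sc s P + sc t Q = sc s' P + sc t' Q) = s" using indep by (intro the_equality) blast+
    then show ?thesis by (simp add: h_def)
  qed
  have mulPQ: "(sc s P + sc t Q) * u = sc (s * cf y [] y u) P + sc (t * cf z [] z u) Q" for s t u
    by (simp add: distrib_right scale_mult_left Pk Qk)
  have addPQ: "(sc s P + sc t Q) + (sc s' P + sc t' Q) = sc (s + s') P + sc (t + t') Q" for s t s' t'
    by (simp add: scale_left_distrib)
  have scPQ: "sc c (sc s P + sc t Q) = sc (c * s) P + sc (c * t) Q" for c s t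
    by (simp add: scale_right_distrib)
  have JI: "sc s P + sc t Q \<in> J" for s t by (auto simp: J_def)
  have "rsub sc J"
  proof -
    have "0 \<in> J" using JI[of 0 0] by simp
    then have "subspace J" unfolding subspace_def by (auto simp: J_def simp del: scale_scale)
      (metis addPQ, metis scPQ)
    moreover have "u * v \<in> J" if "u \<in> J" for u v using that JI mulPQ by (auto simp: J_def)
    ultimately show ?thesis by (simp add: rsub_def)
  qed
  moreover have "h ` J \<subseteq> proj x"
    by (auto simp: J_def h proj_iff scale_mult_right eP)
  moreover have "h (u + v) = h u + h v" if "u \<in> J" "v \<in> J" for u v
  proof -
    from that obtain s t s' t' where "u = sc s P + sc t Q" "v = sc s' P + sc t' Q" unfolding J_def by blast
    then show ?thesis by (simp only: addPQ h) (simp only: scale_left_distrib)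
  qed
  moreover have "h (sc c u) = sc c (h u)" if "u \<in> J" for u c
  proof -
    from that obtain s t where "u = sc s P + sc t Q" unfolding J_def by blast
    then show ?thesis by (simp only: scPQ h) (simp only: scale_scale)
  qed
  moreover have "h (u * v) = h u * v" if "u \<in> J" for u v
  proof -
    from that obtain s t where "u = sc s P + sc t Q" unfolding J_def by blast
    then show ?thesis by (simp only: mulPQ h) (simp add: scale_mult_left Pk)
  qed
  ultimately have "rsub sc J \<and> h ` J \<subseteq> proj x \<and> (\<forall>u\<in>J. \<forall>v\<in>J. h (u + v) = h u + h v) \<and>
      (\<forall>c. \<forall>u\<in>J. h (sc c u) = sc c (h u)) \<and> (\<forall>u\<in>J. \<forall>a. h (u * a) = h u * a)"
    by (intro conjI ballI allI) assumption+
  with inj[unfolded injective_mod_def, THEN spec, of J, THEN spec, of h]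
  have "\<exists>m\<in>proj x. \<forall>j\<in>J. h j = m * j" by (rule mp)
  then obtain m where m: "m \<in> proj x" "\<And>j. j \<in> J \<Longrightarrow> h j = m * j" by metis
  \<comment> \<open>The corner \<open>e x * A * e x\<close> is one-dimensional, so \<open>m\<close>
    acts on \<open>e x * A\<close> as a scalar, whereas \<open>h\<close> fixes \<open>P\<close> and
    kills \<open>Q\<close>.\<close>
  have mm: "m * v = sc (cf x [] x m) v" if v: "e x * v = v" for v
  proof -
    have "m * v = (e x * m * e x) * v" using m(1) v by (simp add: proj_iff mult.assoc)
    then show ?thesis using cf_eq[OF thin_e, of x m] v by (simp add: scale_mult_left)
  qed
  have "P = sc (cf x [] x m) P" using m(2)[of P] mm[OF eP] h[of 1 0] JI[of 1 0] by simp
  moreover have "0 = sc (cf x [] x m) Q" using m(2)[of Q] mm[OF eQ] h[of 0 1] JI[of 0 1] by simp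
  ultimately show False using PQ by auto
qed

section \<open>The ideal \<open>S\<close> in terms of binomial relations\<close>

definition binoms where "binoms = {x. \<exists>ps qs y. binom x ps qs y}"

text \<open>By \<open>binom_unique\<close> the choice merely fixes the order of the two
  sides.\<close>

definition rel where "rel x = (SOME (ps, qs, y). binom x ps qs y)"
abbreviation rel1 where "rel1 x \<equiv> fst (rel x)"
abbreviation rel2 where "rel2 x \<equiv> fst (snd (rel x))"
abbreviation relt where "relt x \<equiv> snd (snd (rel x))"

lemma rel: assumes "x \<in> binoms" shows "binom x (rel1 x) (rel2 x) (relt x)"
proof -
  from assms obtain p where "case p of (ps, qs, y) \<Rightarrow> binom x ps qs y" by (auto simp: binoms_def)
  then have "case rel x of (ps, qs, y) \<Rightarrow> binom x ps qs y" unfolding rel_def by (rule someI)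
  then show ?thesis by (simp add: case_prod_beta)
qed

lemma binoms_iff: "x \<in> binoms \<longleftrightarrow> injective_mod sc (proj x) \<and> \<not> uniserial sc (proj x)"
proof
  assume "x \<in> binoms"
  then obtain ps qs y where b: "binom x ps qs y" by (auto simp: binoms_def)
  then show "injective_mod sc (proj x) \<and> \<not> uniserial sc (proj x)"
    using binom_injective[OF b] not_uniserial[of "hd ps" x "hd qs"] binom_src_hd[OF b]
      binom_src_hd[OF binom_sym[OF b]] binom_hd[OF b] by blast
next
  assume "injective_mod sc (proj x) \<and> \<not> uniserial sc (proj x)"
  then show "x \<in> binoms"
    using uniserial_of_single_arrow[of x] binom_of_injective[of _ x] unfolding binoms_def by blast
qed

definition S where "S = span ((\<lambda>x. M x (rel1 x)) ` binoms)"

lemma S_eq: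
  "S = span (\<Union>x \<in> {x. injective_mod sc (proj x) \<and> \<not> uniserial sc (proj x)}. socle sc (proj x))"
proof -
  have "{x. injective_mod sc (proj x) \<and> \<not> uniserial sc (proj x)} = binoms" using binoms_iff by auto
  moreover have "span (\<Union>x \<in> binoms. socle sc (proj x)) = span ((\<lambda>x. M x (rel1 x)) ` binoms)"
  proof (rule span_eq[THEN iffD2], intro conjI)
    show "(\<Union>x \<in> binoms. socle sc (proj x)) \<subseteq> span ((\<lambda>x. M x (rel1 x)) ` binoms)"
    proof (rule UN_least)
      fix x assume "x \<in> binoms"
      then show "socle sc (proj x) \<subseteq> span ((\<lambda>x. M x (rel1 x)) ` binoms)"
        unfolding binom_socle[OF rel[OF \<open>x \<in> binoms\<close>]] by (intro span_mono) auto
    qed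
    show "(\<lambda>x. M x (rel1 x)) ` binoms \<subseteq> span (\<Union>x \<in> binoms. socle sc (proj x))"
      by (auto intro!: span_base bexI simp: binom_socle[OF rel])
  qed
  ultimately show ?thesis by (simp add: S_def)
qed

end

section \<open>Derivations of the quotient by the socle ideal\<close>

text \<open>Each functional that is dropped enlarges the kernel by one basis vector, its test
  vector. Asking for \<open>x\<close> in every nonempty \<open>Y\<close> encodes an elimination
  order without naming it, and \<open>T\<close> keeps the bases finite, so that \<open>dim\<close>
  counts them.\<close>

lemma (in vector_space) dim_common_kernel:
  fixes \<Phi> :: "'i \<Rightarrow> 'b \<Rightarrow> 'a"
  assumes W: "subspace W" and T: "finite T" "W \<subseteq> span T" and X: "finite X"
    and add: "\<And>x u v. u \<in> W \<Longrightarrow> v \<in> W \<Longrightarrow> \<Phi> x (u + v) = \<Phi> x u + \<Phi> x v"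
    and hom: "\<And>x c u. u \<in> W \<Longrightarrow> \<Phi> x (scale c u) = c * \<Phi> x u"
    and tri: "\<And>Y. Y \<subseteq> X \<Longrightarrow> Y \<noteq> {} \<Longrightarrow> \<exists>x\<in>Y. \<exists>v\<in>W. \<Phi> x v \<noteq> 0 \<and> (\<forall>y\<in>Y - {x}. \<Phi> y v = 0)"
  shows "dim W = dim {v \<in> W. \<forall>x\<in>X. \<Phi> x v = 0} + card X"
  using X tri
proof (induction "card X" arbitrary: X)
  case 0
  then show ?case by simp
next
  case (Suc n)
  let ?K = "\<lambda>Y. {v \<in> W. \<forall>x\<in>Y. \<Phi> x v = 0}"
  have "X \<noteq> {}" using Suc by auto
  then obtain x v where x: "x \<in> X" and v: "v \<in> W" "\<Phi> x v \<noteq> 0" "\<forall>y\<in>X - {x}. \<Phi> y v = 0"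
    using Suc.prems(2)[of X] by auto
  have IH: "dim W = dim (?K (X - {x})) + card (X - {x})"
  proof (rule Suc.hyps(1))
    show "\<exists>z\<in>Y. \<exists>v\<in>W. \<Phi> z v \<noteq> 0 \<and> (\<forall>y\<in>Y - {z}. \<Phi> y v = 0)"
      if "Y \<subseteq> X - {x}" "Y \<noteq> {}" for Y
      by (rule Suc.prems(2)) (use that in auto)
  qed (use Suc.hyps(2) Suc.prems(1) x in auto)
  have zero: "\<Phi> z 0 = 0" for z using hom[of 0 z 0] subspace_0[OF W] by simp
  have sub: "subspace (?K Y)" for Y
    using W by (auto simp: subspace_def zero add hom)
  obtain B where B: "B \<subseteq> ?K X" "independent B" "?K X \<subseteq> span B" "card B = dim (?K X)"
    by (rule basis_exists[of "?K X"])
  have spB: "span B \<subseteq> ?K X" using B(1) sub by (rule span_minimal)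
  have vB: "v \<notin> span B" using spB v x by auto
  have "finite B" using independent_span_bound[OF T(1) B(2)] B(1) T(2) by auto
  have "dim (?K (X - {x})) = card (insert v B)"
  proof (rule dim_unique[OF _ _ independent_insertI[OF vB B(2)] refl])
    show "insert v B \<subseteq> ?K (X - {x})" using B(1) v by auto
    show "?K (X - {x}) \<subseteq> span (insert v B)"
    proof
      fix u assume u: "u \<in> ?K (X - {x})"
      \<comment> \<open>Adding this multiple of \<open>v\<close> cancels the value at
        \<open>x\<close> and leaves the other functionals untouched, since they vanish on
        \<open>v\<close>.\<close>
      let ?c = "- (\<Phi> x u / \<Phi> x v)"
      have "u + scale ?c v \<in> ?K X"
      proof -
        have "\<Phi> z (u + scale ?c v) = 0" if "z \<in> X" for z
          using that u v by (cases "z = x") (auto simp: add hom subspace_scale[OF W] simp del: scale_minus_left)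
        moreover have "u + scale ?c v \<in> W" using u v by (intro subspace_add[OF W] subspace_scale[OF W]) auto
        ultimately show ?thesis by blast
      qed
      then have "u + scale ?c v \<in> span (insert v B)" using B(3) span_mono[of B "insert v B"] by blast
      moreover have "scale ?c v \<in> span (insert v B)" by (intro span_scale span_base) simp
      ultimately have "u + scale ?c v - scale ?c v \<in> span (insert v B)" by (rule span_diff)
      then show "u \<in> span (insert v B)" by simp
    qed
  qed
  also have "\<dots> = Suc (dim (?K X))" using vB span_base[of v B] B(4) \<open>finite B\<close> by (simp add: card_insert_if) blast
  finally show ?case using IH x Suc.prems(1) by (simp add: card_Diff_singleton card_gt_0_iff)
      (metis One_nat_def Suc_pred add_Suc_right card_gt_0_iff empty_iff)
qed

lemma wt_indicator_notin: "a \<notin> set as \<Longrightarrow> wt (\<lambda>b. if b = a then 1 else 0 :: 'k::comm_semiring_1) as = 0"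
  by (induction as) auto

lemma wt_indicator_distinct:
  "distinct as \<Longrightarrow> a \<in> set as \<Longrightarrow> wt (\<lambda>b. if b = a then 1 else 0 :: 'k::comm_semiring_1) as = 1"
  by (induction as) (auto simp: wt_indicator_notin)

lemma wt_decompose:
  fixes t :: "'a::finite \<Rightarrow> 'k::comm_semiring_1"
  shows "wt t as = (\<Sum>a\<in>UNIV. t a * wt (\<lambda>b. if b = a then 1 else 0) as)"
proof (induction as)
  case (Cons b as)
  have "(\<Sum>a\<in>UNIV. t a * (if b = a then 1 else 0)) = t b" by (simp add: if_distrib cong: if_cong)
  then show ?case using Cons by (simp add: distrib_left sum.distrib)
qed simp

context special_biserial_algebra
begin

text \<open>The generators of \<open>S\<close> lie in the corners that carry a binomial relation;
  elsewhere passing to \<open>A/S\<close> changes nothing.\<close>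

lemma S_corner:
  assumes "u \<in> S" "\<not> (x \<in> binoms \<and> y = relt x)"
  shows "e x * u * e y = 0"
  using assms(1) unfolding S_def
proof (induction rule: span_induct)
  case base
  show ?case by (auto simp: subspace_def distrib_left distrib_right scale_mult_left scale_mult_right)
next
  case (step u)
  then obtain z where z: "z \<in> binoms" "u = M z (rel1 z)" by auto
  have w: "wk z (rel1 z) (relt z)" using binom_nz[OF rel[OF z(1)]] by auto
  show ?case using z(2) assms(2) z(1) e_M[OF w, of x] M_e[OF w, of y] by auto
qed

lemma rel_in_S: assumes "x \<in> binoms" shows "M x (rel1 x) \<in> S" "M x (rel2 x) \<in> S"
proof -
  show 1: "M x (rel1 x) \<in> S" unfolding S_def using assms by (intro span_base) auto
  obtain c where "M x (rel2 x) = sc c (M x (rel1 x))"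
    using binom_sym[OF rel[OF assms]] by (auto simp: binom_def)
  then show "M x (rel2 x) \<in> S" using 1 by (simp add: S_def span_scale)
qed

text \<open>The generators are nonzero and lie in different summands \<open>e x * A\<close>, hence
  are independent.\<close>

lemma dim_S: "dim S = card binoms"
proof -
  let ?f = "\<lambda>x. M x (rel1 x)"
  have f: "e x * ?f z = (if x = z then ?f z else 0)" "?f z \<noteq> 0" if "z \<in> binoms" for x z
    using binom_nz[OF rel[OF that]] e_M by auto
  have inj: "inj_on ?f binoms"
    by (rule inj_onI) (metis f)
  have "independent (?f ` binoms)"
  proof (subst dependent_finite)
    show "finite (?f ` binoms)" by simp
    show "\<not> (\<exists>u. (\<exists>v\<in>?f ` binoms. u v \<noteq> 0) \<and> (\<Sum>v\<in>?f ` binoms. sc (u v) v) = 0)"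
    proof
      assume "\<exists>u. (\<exists>v\<in>?f ` binoms. u v \<noteq> 0) \<and> (\<Sum>v\<in>?f ` binoms. sc (u v) v) = 0"
      then obtain u x where u: "x \<in> binoms" "u (?f x) \<noteq> 0" "(\<Sum>v\<in>?f ` binoms. sc (u v) v) = 0" by auto
      then have "0 = e x * (\<Sum>z\<in>binoms. sc (u (?f z)) (?f z))" by (simp add: sum.reindex[OF inj])
      also have "\<dots> = (\<Sum>z\<in>binoms. if z = x then sc (u (?f x)) (?f x) else 0)"
        unfolding sum_distrib_left by (rule sum.cong) (auto simp: scale_mult_right f)
      finally show False using u f by simp
    qed
  qed
  then show ?thesis by (simp add: S_def dim_eq_card_independent card_image[OF inj])
qed

text \<open>There are at most two nonzero walks from \<open>x\<close> to \<open>y\<close>, one for each arrow out of \<open>x\<close>, so a nontrivial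
  linear relation between walks comes from a binomial relation.\<close>

lemma kernel_terms:
  assumes sum0: "(\<Sum>as\<in>walks x y. sc (g as) (M x as)) = 0"
    and as: "as \<in> walks x y" "sc (g as) (M x as) \<noteq> 0"
  shows "\<exists>bs. binom x as bs y"
proof -
  have nz_as: "nz x as y" "g as \<noteq> 0" using as by (auto simp: walks_def)
  have rest: "sc (g as) (M x as) = - (\<Sum>bs\<in>walks x y - {as}. sc (g bs) (M x bs))"
    using sum0 as(1) by (simp add: sum.remove[of _ as] add_eq_0_iff2)
  then have "\<exists>bs\<in>walks x y - {as}. sc (g bs) (M x bs) \<noteq> 0"
    using as(2) sum.neutral[of "walks x y - {as}" "\<lambda>bs. sc (g bs) (M x bs)"] by auto
  then obtain bs where bs: "bs \<in> walks x y" "bs \<noteq> as" "sc (g bs) (M x bs) \<noteq> 0" by blast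
  have nz_bs: "nz x bs y" using bs by (auto simp: walks_def)
  have ne: "us \<noteq> []" if "nz x us y" for us
    using nz_as nz_bs bs(2) that closed_walk_trivial by (metis walk.simps(1))
  have "cs = as \<or> cs = bs" if cs: "nz x cs y" for cs
  proof -
    have src: "src (hd us) = x" if "nz x us y" for us using that ne[OF that] by (cases us) auto
    have eq: "us = vs" if "nz x us y" "nz x vs y" "hd us = hd vs" for us vs
      using that ne[OF that(1)] ne[OF that(2)] parallel_head by (cases us; cases vs) auto
    have "src (hd as) = src (hd bs)" "src (hd bs) = src (hd cs)"
      using src[OF cs] src[OF nz_as(1)] src[OF nz_bs] by simp_all
    from out2[OF this] show ?thesis
      using eq[OF cs nz_as(1)] eq[OF cs nz_bs] eq[OF nz_bs nz_as(1)] bs(2) by metis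
  qed
  then have "(\<Sum>cs\<in>walks x y - {as}. sc (g cs) (M x cs)) = (\<Sum>cs\<in>walks x y - {as}. if cs = bs then sc (g bs) (M x bs) else 0)"
    by (intro sum.cong) (auto simp: walks_def)
  also have "\<dots> = sc (g bs) (M x bs)" using bs by (subst sum.delta) auto
  finally have "sc (g as) (M x as) = sc (- g bs) (M x bs)" using rest by simp
  then have "sc (inverse (g as)) (sc (g as) (M x as)) = sc (inverse (g as)) (sc (- g bs) (M x bs))" by simp
  then have "M x as = sc (inverse (g as) * - g bs) (M x bs)" using nz_as(2) by simp
  then show ?thesis using nz_as nz_bs bs(2) unfolding binom_def by blast
qed

text \<open>Applying the normal form to both sides of the relation, the inner parts agree by
  linearity, and the weights remain as scalars in front of the nonzero
  \<open>M x ps\<close>.\<close>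

lemma Der_weight_balanced:
  assumes D: "D \<in> Der sc" and b: "binom x ps qs y"
  shows "wt (tau D) ps = wt (tau D) qs"
proof -
  obtain c where c: "\<And>x as y. wk x as y \<Longrightarrow> D (M x as) = sc (wt (tau D) as) (M x as) + inner c (M x as)"
    using Der_normal_form[OF D] by metis
  obtain k where k: "M x ps = sc k (M x qs)" using b by (auto simp: binom_def)
  have "sc (wt (tau D) ps) (M x ps) + inner c (M x ps) = D (M x ps)"
    using c binom_nz[OF b] by simp
  also have "\<dots> = sc k (D (M x qs))" by (simp add: k DerD(2)[OF D])
  also have "\<dots> = sc k (sc (wt (tau D) qs) (M x qs) + inner c (M x qs))"
    using c binom_nz(2)[OF b] by simp
  also have "\<dots> = sc (wt (tau D) qs) (M x ps) + inner c (M x ps)"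
    by (simp add: k scale_right_distrib DerD(2)[OF inner_Der] mult.commute)
  finally show ?thesis using binom_nz[OF b] by simp
qed

text \<open>In a corner with a nontrivial linear relation all nonzero walks are sides of one
  binomial relation. Balanced weights multiply the whole sum by one scalar, so it stays
  zero.\<close>

lemma balanced_weight_derivation:
  assumes bal: "\<And>x. x \<in> binoms \<Longrightarrow> wt t (rel1 x) = wt t (rel2 x)"
  obtains D where "D \<in> Der sc" "\<And>x as y. wk x as y \<Longrightarrow> D (M x as) = sc (wt t as) (M x as)"
proof (rule weight_derivation[of t])
  fix x y g
  assume s0: "(\<Sum>as\<in>walks x y. sc (g as) (M x as)) = 0"
  show "(\<Sum>as\<in>walks x y. sc (g as * wt t as) (M x as)) = 0"
  proof (cases "\<exists>as\<in>walks x y. sc (g as) (M x as) \<noteq> 0")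
    case False
    then show ?thesis by (intro sum.neutral) auto
  next
    case True
    then obtain as bs where as: "as \<in> walks x y" and b: "binom x as bs y" using kernel_terms[OF s0] by blast
    then have x: "x \<in> binoms" by (auto simp: binoms_def)
    have w: "wt t as = wt t bs" using binom_unique(2)[OF rel[OF x] b] bal[OF x] by auto
    have "(\<Sum>cs\<in>walks x y. sc (g cs * wt t cs) (M x cs)) = (\<Sum>cs\<in>walks x y. sc (wt t as) (sc (g cs) (M x cs)))"
    proof (rule sum.cong[OF refl])
      fix cs assume "cs \<in> walks x y"
      then show "sc (g cs * wt t cs) (M x cs) = sc (wt t as) (sc (g cs) (M x cs))"
        using binom_parallel[OF b, of cs] w by (cases "M x cs = 0") (auto simp: walks_def mult.commute)
    qed
    also have "\<dots> = sc (wt t as) (\<Sum>cs\<in>walks x y. sc (g cs) (M x cs))" by (rule scale_sum_right[symmetric])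
    also have "\<dots> = 0" using s0 by simp
    finally show ?thesis .
  qed
qed (use that in blast)

end

section \<open>The projection onto \<open>A/S\<close> and the induced map on derivations\<close>

locale special_biserial_quotient = special_biserial_algebra sc src tgt M
  for sc :: "'k::field \<Rightarrow> 'A::ring_1 \<Rightarrow> 'A" and src tgt :: "'a::finite \<Rightarrow> 'v::finite"
    and M :: "'v \<Rightarrow> 'a list \<Rightarrow> 'A" +
  fixes sc' :: "'k \<Rightarrow> 'B::ring_1 \<Rightarrow> 'B" and q :: "'A \<Rightarrow> 'B"
  assumes kalg': "kalg sc'" and quotient: "quotient_map sc sc' S q"
begin

lemma q_hom: "q (u + v) = q u + q v" "q (u * v) = q u * q v" "q (sc c u) = sc' c (q u)" "q 1 = 1"
  and q_surj: "surj q" and q_eq_0: "q u = 0 \<longleftrightarrow> u \<in> S"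
  using quotient by (auto simp: quotient_map_def)

lemma q_0: "q 0 = 0" using q_hom(1)[of 0 0] by simp

lemma q_diff: "q (u - v) = q u - q v" using q_hom(1)[of "u - v" v] by (simp add: algebra_simps)

lemma q_sum: "q (sum f X) = (\<Sum>i\<in>X. q (f i))"
  by (induction X rule: infinite_finite_induct) (auto simp: q_0 q_hom)

sublocale B: vector_space sc' using kalg' by (simp add: kalg_def)

text \<open>The point is that no vertex and no arrow falls into \<open>S\<close>: the sides of a
  binomial relation are not closed, and they are not parallel to an arrow, since without bypass both
  would equal it.\<close>

sublocale B: path_algebra_quotient sc' src tgt "\<lambda>x as. q (M x as)"
proof
  show "sc' c u * v = sc' c (u * v)" "u * sc' c v = sc' c (u * v)" for c u v
    using kalg' unfolding kalg_def by metis+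
  show "(\<Sum>x\<in>UNIV. q (e x)) = 1" by (simp add: sum_M_vertex q_hom flip: q_sum)
  show "B.span {q (M x as) | x as y. wk x as y} = UNIV"
  proof (intro equalityI subsetI)
    fix v :: 'B
    obtain u where u: "v = q u" using q_surj by (metis surjD)
    show "v \<in> B.span {q (M x as) | x as y. wk x as y}"
      unfolding u
    proof (rule subspace_UNIV_I[of "\<lambda>u. q u \<in> B.span {q (M x as) | x as y. wk x as y}"])
      show "subspace {u. q u \<in> B.span {q (M x as) | x as y. wk x as y}}"
        by (auto simp: subspace_def q_hom q_0 B.span_zero B.span_add B.span_scale)
    qed (auto intro!: B.span_base)
  qed simp
  show "q (e x) \<noteq> 0" for x
  proof
    assume "q (e x) = 0"
    moreover have "\<not> (x \<in> binoms \<and> x = relt x)"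
      using binom_nz[OF rel, of x] binom_not_Nil[OF rel, of x] closed_walk_trivial by metis
    ultimately have "e x * e x * e x = 0" by (intro S_corner) (auto simp: q_eq_0)
    then show False using M_vertex_nonzero by simp
  qed
  show "q (ar a) \<noteq> 0" for a
  proof
    assume "q (ar a) = 0"
    moreover have "\<not> (src a \<in> binoms \<and> tgt a = relt (src a))"
      using binom_nz[OF rel, of "src a"] no_bypass by metis
    ultimately have "e (src a) * ar a * e (tgt a) = 0" by (intro S_corner) (auto simp: q_eq_0)
    then show False using M_arrow_nonzero by (simp add: e_ar)
  qed
qed (use M_mult no_bypass M_vertex_orthogonal q_0 in \<open>auto simp flip: q_hom\<close>)

text \<open>The relations of \<open>A/S\<close> are monomial, so every choice of weights on the arrows gives a derivation.\<close>

lemma B_weight_derivation: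
  obtains E where "E \<in> Der sc'" "\<And>x as y. wk x as y \<Longrightarrow> E (q (M x as)) = sc' (wt t as) (q (M x as))"
proof (rule B.weight_derivation[of t])
  fix x y g
  assume s0: "(\<Sum>as\<in>walks x y. sc' (g as) (q (M x as))) = 0"
  let ?u = "\<Sum>as\<in>walks x y. sc (g as) (M x as)"
  have "q ?u = 0" using s0 by (simp add: q_sum q_hom)
  then have uS: "?u \<in> S" by (simp add: q_eq_0)
  \<comment> \<open>Each term vanishes on its own: in the corner of a binomial relation all walks
    lie in \<open>S\<close>; in any other corner the sum is already zero in \<open>A\<close>, and a
    nonzero term would produce a binomial relation there.\<close>
  have "sc' (g as) (q (M x as)) = 0" if as: "as \<in> walks x y" for as
  proof (cases "x \<in> binoms \<and> y = relt x")
    case True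
    then show ?thesis
      using binom_parallel[OF rel, of x as] rel_in_S[of x] as q_0
      by (cases "M x as = 0") (auto simp: walks_def q_eq_0[THEN iffD2])
  next
    case False
    have "?u = e x * ?u * e y"
      by (auto simp: sum_distrib_left sum_distrib_right scale_mult_left scale_mult_right walks_def
          e_M[of x _ y] M_e[of x _ y] intro!: sum.cong)
    then have "?u = 0" using S_corner[OF uS False] by simp
    then have "sc (g as) (M x as) = 0"
      using kernel_terms[OF _ as, of g] False binom_unique(1)[OF rel, of x] unfolding binoms_def by blast
    then show ?thesis by (metis q_hom(3) q_0)
  qed
  then show "(\<Sum>as\<in>walks x y. sc' (g as * wt t as) (q (M x as))) = 0"
    by (intro sum.neutral ballI) (metis B.scale_scale B.scale_zero_right mult.commute)
qed (use that in blast)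

text \<open>On a generator of \<open>S\<close> the derivation is a scalar plus an inner derivation,
  and both stay in \<open>S\<close>, the kernel of the ring map \<open>q\<close>.\<close>

lemma Der_S: assumes D: "D \<in> Der sc" and u: "u \<in> S" shows "D u \<in> S"
proof -
  obtain c where c: "\<And>x as y. wk x as y \<Longrightarrow> D (M x as) = sc (wt (tau D) as) (M x as) + inner c (M x as)"
    using Der_normal_form[OF D] by metis
  show ?thesis using u unfolding S_def
  proof (induction rule: span_induct)
    case base
    show ?case using D by (auto simp: subspace_def DerD span_zero span_add span_scale)
  next
    case (step u)
    then obtain x where x: "x \<in> binoms" "u = M x (rel1 x)" by auto
    have "q u = 0" using rel_in_S[OF x(1)] x(2) q_eq_0 by simp
    moreover have "wk x (rel1 x) (relt x)" using binom_nz[OF rel[OF x(1)]] by auto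
    ultimately have "q (D u) = 0" using c[of x "rel1 x"] x(2)
      by (simp add: inner_def q_hom q_diff)
    then show ?case by (simp add: q_eq_0 S_def)
  qed
qed

text \<open>Every derivation of \<open>A\<close> preserves \<open>S\<close>, so \<open>P D\<close> does not depend on the chosen preimage.\<close>

definition P :: "('A \<Rightarrow> 'A) \<Rightarrow> 'B \<Rightarrow> 'B" where
  "P D b = q (D (SOME u. q u = b))"

lemma P_q: assumes D: "D \<in> Der sc" shows "P D (q u) = q (D u)"
proof -
  have "q (SOME v. q v = q u) = q u" by (rule someI) simp
  then have "(SOME v. q v = q u) - u \<in> S" by (simp add: q_diff flip: q_eq_0)
  then have "D ((SOME v. q v = q u) - u) \<in> S" using Der_S[OF D] by blast
  then show ?thesis by (simp add: P_def DerD[OF D] q_diff flip: q_eq_0)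
qed

lemma q_cases: obtains u where "b = q u"
  using q_surj by (metis surjD)

lemma P_Der: assumes D: "D \<in> Der sc" shows "P D \<in> Der sc'"
proof -
  have "P D (a + b) = P D a + P D b" "P D (a * b) = P D a * b + a * P D b" "P D (sc' c a) = sc' c (P D a)"
    for a b c
    by (cases a rule: q_cases; cases b rule: q_cases;
        simp add: P_q[OF D] DerD[OF D] flip: q_hom)+
  then show ?thesis by (simp add: B.Der_iff)
qed

lemma commutator_Der: assumes "D \<in> Der sc" "E \<in> Der sc" shows "commutator D E \<in> Der sc"
  using assms unfolding Der_iff by (auto simp: commutator_def algebra_simps scale_right_diff_distrib)

lemma P_commutator:
  assumes "D \<in> Der sc" "E \<in> Der sc"
  shows "P (commutator D E) = commutator (P D) (P E)"
proof
  fix b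
  show "P (commutator D E) b = commutator (P D) (P E) b"
    using assms P_q[OF commutator_Der[OF assms]]
    by (cases b rule: q_cases) (simp add: P_q commutator_def q_diff)
qed

lemma tau_P: assumes D: "D \<in> Der sc" shows "B.tau (P D) = tau D"
proof
  fix a
  show "B.tau (P D) a = tau D a" unfolding B.tau_def
    by (rule B.cf_unique[OF B.thin_ar]) (simp add: P_q[OF D] tau_def cf_eq[OF thin_ar] flip: q_hom)
qed

text \<open>The weights of \<open>D\<close> can be read off in \<open>A/S\<close>. If \<open>P D\<close> is inner they are differences of a function
  on the vertices, which makes the diagonal part of \<open>D\<close> inner.\<close>

lemma inner_of_P_inner: assumes D: "D \<in> Der sc" and P: "P D = inner b" shows "\<exists>a. D = inner a"
proof -
  obtain c where c: "\<And>x as y. wk x as y \<Longrightarrow> D (M x as) = sc (wt (tau D) as) (M x as) + inner c (M x as)"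
    using Der_normal_form[OF D] by metis
  let ?\<beta> = "\<lambda>x. B.cf x [] x b"
  let ?d = "\<Sum>z\<in>UNIV. sc (?\<beta> z) (e z)"
  have "D (M x as) = inner (?d + c) (M x as)" if w: "wk x as y" for x as y
  proof -
    have "wt (tau D) as = ?\<beta> x - ?\<beta> y"
      using B.wt_tau_inner[OF w, of b] tau_P[OF D] P by simp
    moreover have "?d * M x as = sc (?\<beta> x) (M x as)"
    proof -
      have "?d * M x as = (\<Sum>z\<in>UNIV. if z = x then sc (?\<beta> x) (M x as) else 0)"
        unfolding sum_distrib_right by (rule sum.cong) (auto simp: scale_mult_left e_M[OF w])
      then show ?thesis by simp
    qed
    moreover have "M x as * ?d = sc (?\<beta> y) (M x as)"
    proof -
      have "M x as * ?d = (\<Sum>z\<in>UNIV. if z = y then sc (?\<beta> y) (M x as) else 0)"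
        unfolding sum_distrib_left by (rule sum.cong) (auto simp: scale_mult_right M_e[OF w])
      then show ?thesis by simp
    qed
    ultimately show ?thesis
      using c[OF w] by (simp add: inner_def distrib_left distrib_right scale_left_diff_distrib)
  qed
  then have "D = inner (?d + c)" by (intro Der_eqI[OF D inner_Der])
  then show ?thesis by blast
qed

section \<open>The obstructions to lifting a derivation, and the dimension count\<close>

definition \<Phi> where "\<Phi> x E = wt (B.tau E) (rel1 x) - wt (B.tau E) (rel2 x)"

text \<open>Lifting the weights to \<open>A\<close> is possible exactly when they balance, and inner
  derivations always balance. \<open>Inn\<close> is added to obtain the full preimage of the image
  of \<open>p^*\<close> among the derivations of \<open>A/S\<close>.\<close>

lemma image_P_plus_Inn:
  "{E + F | E F. E \<in> P ` Der sc \<and> F \<in> Inn} = {E \<in> Der sc'. \<forall>x\<in>binoms. \<Phi> x E = 0}" (is "?L = ?R")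
proof (intro equalityI subsetI)
  fix G assume "G \<in> ?L"
  then obtain D c where D: "D \<in> Der sc" and G: "G = P D + inner c" by (auto simp: Inn_eq_range)
  have "\<Phi> x G = 0" if x: "x \<in> binoms" for x
  proof -
    have "wt (B.tau (inner c)) (rel1 x) = wt (B.tau (inner c)) (rel2 x)"
      using B.wt_tau_inner binom_nz[OF rel[OF x]] by metis
    then show ?thesis
      unfolding \<Phi>_def G B.wt_tau_add tau_P[OF D] using Der_weight_balanced[OF D rel[OF x]] by simp
  qed
  then show "G \<in> ?R" using G B.Der_add[OF P_Der[OF D] B.inner_Der] by simp
next
  fix G assume "G \<in> ?R"
  then have G: "G \<in> Der sc'" and bal: "\<And>x. x \<in> binoms \<Longrightarrow> wt (B.tau G) (rel1 x) = wt (B.tau G) (rel2 x)"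
    by (auto simp: \<Phi>_def)
  obtain D where D: "D \<in> Der sc" and DM: "\<And>x as y. wk x as y \<Longrightarrow> D (M x as) = sc (wt (B.tau G) as) (M x as)"
    using balanced_weight_derivation[of "B.tau G"] bal by metis
  obtain c where c: "\<And>x as y. wk x as y \<Longrightarrow>
      G (q (M x as)) = sc' (wt (B.tau G) as) (q (M x as)) + inner c (q (M x as))"
    using B.Der_normal_form[OF G] by metis
  have "G = P D + inner c"
    by (rule B.Der_eqI[OF G B.Der_add[OF P_Der[OF D] B.inner_Der]])
      (use c DM in \<open>simp add: P_q[OF D] q_hom\<close>)
  then show "G \<in> ?L" using D by (auto simp: Inn_eq_range)
qed

sublocale F: vector_space "fscale sc'"
  by (rule vector_space_fscale) (rule B.vector_space_axioms)

lemma subspace_Der: "F.subspace (Der sc')"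
proof -
  have "0 \<in> Der sc'" by (simp add: B.Der_iff)
  then show ?thesis unfolding F.subspace_def using B.Der_add B.Der_fscale by blast
qed

text \<open>One derivation for each arrow and one inner derivation for each walk suffice by the
  normal form. Without finiteness \<open>dim\<close> would not measure the space.\<close>

lemma Der_finite_span: "\<exists>T. finite T \<and> Der sc' \<subseteq> F.span T"
proof -
  have "\<exists>E. E \<in> Der sc' \<and> (\<forall>x as y. wk x as y \<longrightarrow>
      E (q (M x as)) = sc' (wt (\<lambda>b. if b = a then 1 else 0) as) (q (M x as)))" for a
    using B_weight_derivation[of "\<lambda>b. if b = a then 1 else 0"] by metis
  then obtain E where E: "\<And>a. E a \<in> Der sc'" "\<And>a x as y. wk x as y \<Longrightarrow>
      E a (q (M x as)) = sc' (wt (\<lambda>b. if b = a then 1 else 0) as) (q (M x as))" by metis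
  let ?T = "range E \<union> (\<Union>x. \<Union>y. (\<lambda>as. inner (q (M x as))) ` walks x y)"
  have inn: "inner c \<in> F.span ?T" for c
  proof (rule B.subspace_UNIV_I[of "\<lambda>c. inner c \<in> F.span ?T"])
    have "inner (0::'B) = 0" "inner (u + v) = inner u + inner v" "inner (sc' k u) = fscale sc' k (inner u)" for u v k
      by (auto simp: fun_eq_iff inner_def fscale_def algebra_simps B.scale_mult_left B.scale_mult_right
          B.scale_right_diff_distrib)
    then show "B.subspace {c. inner c \<in> F.span ?T}"
      by (simp add: B.subspace_def F.span_zero F.span_add F.span_scale)
  qed (auto intro!: F.span_base simp: walks_def)
  have "G \<in> F.span ?T" if G: "G \<in> Der sc'" for G
  proof -
    obtain c where c: "\<And>x as y. wk x as y \<Longrightarrow>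
        G (q (M x as)) = sc' (wt (B.tau G) as) (q (M x as)) + inner c (q (M x as))"
      using B.Der_normal_form[OF G] by metis
    let ?E = "\<Sum>a\<in>UNIV. fscale sc' (B.tau G a) (E a)"
    have ED: "?E \<in> Der sc'"
      by (intro F.subspace_sum[OF subspace_Der] B.Der_fscale E(1))
    have app: "(\<Sum>a\<in>X. fscale sc' (f a) (E a)) u = (\<Sum>a\<in>X. sc' (f a) (E a u))" for X f u
      by (induction X rule: infinite_finite_induct) (auto simp: fscale_def)
    have "G = ?E + inner c"
    proof (rule B.Der_eqI[OF G B.Der_add[OF ED B.inner_Der]])
      fix x as y assume w: "wk x as y"
      have "?E (q (M x as)) = (\<Sum>a\<in>UNIV. sc' (B.tau G a * wt (\<lambda>b. if b = a then 1 else 0) as) (q (M x as)))"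
        unfolding app by (simp add: E(2)[OF w])
      also have "\<dots> = sc' (wt (B.tau G) as) (q (M x as))"
        by (simp add: wt_decompose[of "B.tau G"] flip: B.scale_sum_left)
      finally show "G (q (M x as)) = (?E + inner c) (q (M x as))" using c[OF w] by simp
    qed
    moreover have "?E + inner c \<in> F.span ?T"
      by (intro F.span_add inn F.span_sum F.span_scale F.span_base) auto
    ultimately show ?thesis by (simp only:)
  qed
  moreover have "finite ?T" by simp
  ultimately show ?thesis by blast
qed

text \<open>The weight of the first arrow of \<open>rel1 x\<close> occurs only in those \<open>\<Phi> y\<close> for which a walk leads
  from \<open>y\<close> to \<open>x\<close>.\<close>

lemma \<Phi>_triangular:
  assumes Y: "Y \<subseteq> binoms" "Y \<noteq> {}"
  shows "\<exists>x\<in>Y. \<exists>E\<in>Der sc'. \<Phi> x E \<noteq> 0 \<and> (\<forall>y\<in>Y - {x}. \<Phi> y E = 0)"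
proof -
  define reach where "reach x = {z. \<exists>as. wk x as z}" for x
  \<comment> \<open>A vertex of \<open>Y\<close> that reaches the most vertices: another
    \<open>y\<close> leading to it would reach strictly more, namely also \<open>y\<close>
    itself.\<close>
  have "Max ((\<lambda>y. card (reach y)) ` Y) \<in> (\<lambda>y. card (reach y)) ` Y" using Y(2) by (intro Max_in) auto
  then obtain x where x: "x \<in> Y" and max: "card (reach x) = Max ((\<lambda>y. card (reach y)) ` Y)" by auto
  have nowalk: "y = x" if y: "y \<in> Y" and w: "wk y as x" for y as
  proof (rule ccontr)
    assume ne: "y \<noteq> x"
    have "reach x \<subseteq> reach y" using w by (auto simp: reach_def) (metis walk_append)
    moreover have "y \<in> reach y" by (auto simp: reach_def intro: exI[of _ "[]"])
    moreover have "y \<notin> reach x"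
    proof
      assume "y \<in> reach x"
      then obtain bs where "wk x bs y" by (auto simp: reach_def)
      then have "wk y (as @ bs) y" using w by (auto simp: walk_append)
      then have "as = []" using closed_walk_trivial by blast
      then show False using w ne by simp
    qed
    ultimately have "reach x \<subset> reach y" by blast
    then have "card (reach x) < card (reach y)" by (intro psubset_card_mono) auto
    moreover have "card (reach y) \<le> Max ((\<lambda>y. card (reach y)) ` Y)"
      using y by (intro Max_ge imageI finite_imageI) auto
    ultimately show False using max by linarith
  qed
  have xb: "x \<in> binoms" using x Y by blast
  note b = rel[OF xb]
  define a where "a = hd (rel1 x)"
  have a: "src a = x" "a \<in> set (rel1 x)"
    using binom_src_hd[OF b] binom_not_Nil[OF b] by (auto simp: a_def)
  obtain E where E: "E \<in> Der sc'" and EM: "\<And>x as y. wk x as y \<Longrightarrow>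
      E (q (M x as)) = sc' (wt (\<lambda>b. if b = a then 1 else 0) as) (q (M x as))"
    using B_weight_derivation[of "\<lambda>b. if b = a then 1 else 0"] by metis
  have tau: "B.tau E = (\<lambda>b. if b = a then 1 else 0)" by (rule B.tau_weight[OF EM])
  have a_walk: "\<exists>us vs. as = us @ a # vs \<and> wk y us x" if "wk y as z" "a \<in> set as" for y as z
  proof -
    from that(2) obtain us vs where "as = us @ a # vs" by (meson split_list)
    then show ?thesis using that(1) a(1) by (auto simp: walk_append)
  qed
  have "a \<notin> set (rel2 x)"
  proof
    assume "a \<in> set (rel2 x)"
    then obtain us vs where uv: "rel2 x = us @ a # vs" "wk x us x" using a_walk binom_nz(2)[OF b] by blast
    then have "us = []" using closed_walk_trivial by blast
    then show False using uv binom_hd[OF b] by (simp add: a_def)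
  qed
  \<comment> \<open>The arrow \<open>a\<close> occurs once in \<open>rel1 x\<close>, as walks are
    distinct, and not in \<open>rel2 x\<close>.\<close>
  then have "\<Phi> x E = 1"
    unfolding \<Phi>_def tau
    using wt_indicator_distinct[OF walk_distinct[OF binom_nz(1)[OF b]] a(2), where 'k = 'k]
      wt_indicator_notin[of a "rel2 x", where 'k = 'k] by simp
  moreover have "\<Phi> y E = 0" if y: "y \<in> Y - {x}" for y
  proof -
    have yb: "y \<in> binoms" using y Y by blast
    have "a \<notin> set as" if "wk y as z" for as z
      using a_walk[OF that] nowalk[of y] y by blast
    then have "a \<notin> set (rel1 y)" "a \<notin> set (rel2 y)" using binom_nz[OF rel[OF yb]] by blast+
    then show ?thesis unfolding \<Phi>_def tau by (simp add: wt_indicator_notin)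
  qed
  ultimately show ?thesis using x E by (metis one_neq_zero)
qed

text \<open>Both spaces of derivations contain \<open>Inn\<close>, so after dividing by it this says
  that the cokernel of \<open>p^*\<close> has dimension \<open>dim S\<close>.\<close>

lemma dim_Der:
  "F.dim (Der sc') = F.dim {E + F | E F. E \<in> P ` Der sc \<and> F \<in> Inn} + dim S"
proof -
  obtain T where T: "finite T" "Der sc' \<subseteq> F.span T" using Der_finite_span by blast
  have "F.dim (Der sc') = F.dim {E \<in> Der sc'. \<forall>x\<in>binoms. \<Phi> x E = 0} + card binoms"
    by (rule F.dim_common_kernel[OF subspace_Der T])
      (use \<Phi>_triangular in \<open>simp_all add: \<Phi>_def B.wt_tau_add B.wt_tau_fscale right_diff_distrib\<close>)
  then show ?thesis by (simp only: image_P_plus_Inn dim_S)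
qed

end

section \<open>The short exact sequence\<close>

lemma pel_pathalg: "walk src tgt x as y \<Longrightarrow> pel (x, as) \<in> pathalg src tgt"
  using valid_path_iff_walk[of src tgt x as] by (auto simp: pathalg_def pel_def)

text \<open>Only binary additivity of \<open>\<pi>\<close> is given, so the sum is built up along
  the restrictions of \<open>f\<close> to finite sets of paths.\<close>

lemma presents_expansion:
  assumes pres: "presents src tgt I sc \<pi>" and f: "f \<in> pathalg src tgt"
    and supp: "finite F" "{p. f p \<noteq> 0} \<subseteq> F" "F \<subseteq> {p. valid_path src tgt p}"
  shows "\<pi> f = (\<Sum>p\<in>F. sc (f p) (\<pi> (pel p)))"
proof -
  note pi = pres[unfolded presents_def]
  define r where "r G = (\<lambda>p. if p \<in> G then f p else 0)" for G
  have rP: "r G \<in> pathalg src tgt" for G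
    using f by (auto simp: pathalg_def r_def elim: rev_finite_subset)
  have pel: "pel p \<in> pathalg src tgt" if "valid_path src tgt p" for p
    using that by (auto simp: pathalg_def pel_def)
  have scP: "pscale c g \<in> pathalg src tgt" if "g \<in> pathalg src tgt" for c g
    using that by (auto simp: pathalg_def pscale_def elim: rev_finite_subset)
  have "\<pi> (r G) = (\<Sum>p\<in>G. sc (f p) (\<pi> (pel p)))" if "finite G" "G \<subseteq> F" for G
    using that
  proof (induction G)
    case empty
    have "r {} + r {} = r {}" by (auto simp: r_def)
    then have "\<pi> (r {}) + \<pi> (r {}) = \<pi> (r {})" using pi rP by metis
    then show ?case by simp
  next
    case (insert p G)
    have p: "valid_path src tgt p" using insert supp by auto
    have "r (insert p G) = pscale (f p) (pel p) + r G"
      using insert by (auto simp: r_def fun_eq_iff pscale_def pel_def)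
    moreover have "\<pi> (pscale (f p) (pel p) + r G) = \<pi> (pscale (f p) (pel p)) + \<pi> (r G)"
      using pi rP scP[OF pel[OF p]] by blast
    moreover have "\<pi> (pscale (f p) (pel p)) = sc (f p) (\<pi> (pel p))"
      using pi pel[OF p] by blast
    ultimately show ?case using insert.hyps insert.IH insert.prems by (simp only: sum.insert) simp
  qed
  from this[of F] supp(1) have "\<pi> (r F) = (\<Sum>p\<in>F. sc (f p) (\<pi> (pel p)))" by simp
  moreover have "r F = f" using supp(2) by (auto simp: r_def fun_eq_iff)
  ultimately show ?thesis by simp
qed

lemma presents_special_biserial:
  fixes src tgt :: "'a::finite \<Rightarrow> 'v::finite"
    and I :: "(('v,'a) path \<Rightarrow> 'k::field) set"
    and sc :: "'k \<Rightarrow> 'A::ring_1 \<Rightarrow> 'A"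
  assumes sb: "special_biserial src tgt I" and no_bypass: "\<not> has_bypass src tgt"
    and A_alg: "kalg sc" and pres: "presents src tgt I sc \<pi>"
  shows "special_biserial_algebra sc src tgt (\<lambda>x as. \<pi> (pel (x, as)))"
proof -
  note pi = pres[unfolded presents_def]
  have pelP: "(pel (x, as) :: ('v,'a) path \<Rightarrow> 'k) \<in> pathalg src tgt" if "walk src tgt x as y" for x as y
    using pel_pathalg[OF that] .
  have pimul: "\<pi> f * \<pi> g = \<pi> (pmul tgt f g)" if "f \<in> pathalg src tgt" "g \<in> pathalg src tgt" for f g
    using pi that by simp
  \<comment> \<open>The ideal lies in the square of the arrow ideal; this is what keeps vertices and
    arrows nonzero in \<open>A\<close>.\<close>
  have I: "pel p \<notin> I" if "length (snd p) < 2" for p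
  proof
    assume "pel p \<in> I"
    then have "pel p \<in> (arrow_pow src tgt 2 :: (('v,'a) path \<Rightarrow> 'k) set)"
      using sb by (auto simp: special_biserial_def admissible_def)
    then have "(pel p p :: 'k) \<noteq> 0 \<longrightarrow> 2 \<le> length (snd p)" unfolding arrow_pow_def by blast
    then show False using that by (simp add: pel_def)
  qed
  have nz: "\<pi> (pel (x, as)) \<noteq> 0 \<longleftrightarrow> pel (x, as) \<notin> I" if "walk src tgt x as y" for x as y
    using pi pelP[OF that] by blast
  have zero: "\<pi> 0 = 0"
  proof -
    have "0 \<in> (pathalg src tgt :: (('v,'a) path \<Rightarrow> 'k) set)" by (auto simp: pathalg_def)
    moreover have "0 \<in> I" using sb by (auto simp: special_biserial_def admissible_def two_sided_ideal_def)
    ultimately show ?thesis using pi by blast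
  qed
  interpret vector_space sc using A_alg by (simp add: kalg_def)
  have three: "a = b \<or> b = c \<or> a = c" if "card {z. P z} \<le> 2" "P a" "P b" "P c" for a b c :: 'a and P
  proof (rule ccontr)
    assume "\<not> ?thesis"
    then have "card {a, b, c} = 3" by auto
    moreover have "card {a, b, c} \<le> card {z. P z}" using that by (intro card_mono) auto
    ultimately show False using that(1) by simp
  qed
  have two: "b = c" if "card {z. P z} \<le> 1" "P b" "P c" for b c :: 'a and P
    using that card_le_Suc0_iff_eq[of "{z. P z}"] by auto
  show ?thesis
  proof
    show "sc c u * v = sc c (u * v)" "u * sc c v = sc c (u * v)" for c u v
      using A_alg unfolding kalg_def by metis+
    show "as = [a]" if "walk src tgt (src a) as (tgt a)" for a as
    proof (rule ccontr)
      assume "as \<noteq> [a]"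
      then have "valid_path src tgt (src a, as) \<and> (src a, as) \<noteq> (src a, [a]) \<and>
          fst (src a, as) = src a \<and> path_tgt tgt (src a, as) = tgt a"
        using that valid_path_walk_iff[of src tgt "src a" as "tgt a"] by simp
      then show False using no_bypass unfolding has_bypass_def by blast
    qed
    show "\<pi> (pel (x, as)) * \<pi> (pel (y, bs)) = \<pi> (pel (x, as @ bs))"
      if "walk src tgt x as y" "walk src tgt y bs z" for x as y bs z
      using pimul[OF pelP[OF that(1)] pelP[OF that(2)]] by (simp add: pmul_pel[OF that(1)])
    show "\<pi> (pel (x, [])) * \<pi> (pel (y, [])) = 0" if "x \<noteq> y" for x y
    proof -
      have w: "walk src tgt z [] z" for z by simp
      show ?thesis using that pimul[OF pelP[OF w[of x]] pelP[OF w[of y]]]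
        by (simp add: pmul_pel[OF w[of x]] zero)
    qed
    show "(\<Sum>x\<in>UNIV. \<pi> (pel (x, []))) = 1"
    proof -
      have supp: "{p. (punit :: ('v,'a) path \<Rightarrow> 'k) p \<noteq> 0} = range (\<lambda>x. (x, []))"
        by (auto simp: punit_def)
      have val: "range (\<lambda>x. (x, [])) \<subseteq> {p. valid_path src tgt p}" by (auto simp: valid_path_def)
      have "punit \<in> (pathalg src tgt :: (('v,'a) path \<Rightarrow> 'k) set)"
        using val unfolding pathalg_def supp by (auto simp: supp) (auto simp: punit_def valid_path_def split: if_splits)
      then have "\<pi> punit = (\<Sum>p\<in>range (\<lambda>x. (x, [])). sc (punit p) (\<pi> (pel p)))"
        by (rule presents_expansion[OF pres]) (use supp val in auto)
      also have "\<dots> = (\<Sum>x\<in>UNIV. \<pi> (pel (x, [])))"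
        by (subst sum.reindex) (auto simp: inj_on_def punit_def)
      finally show ?thesis using pi by simp
    qed
    show "span {\<pi> (pel (x, as)) | x as y. walk src tgt x as y} = UNIV"
    proof (intro equalityI subsetI)
      fix u
      have "u \<in> \<pi> ` pathalg src tgt" using pi by simp
      then obtain f where f: "f \<in> pathalg src tgt" and u: "u = \<pi> f" by auto
      have "u = (\<Sum>p\<in>{p. f p \<noteq> 0}. sc (f p) (\<pi> (pel p)))"
        unfolding u by (rule presents_expansion[OF pres f]) (use f in \<open>auto simp: pathalg_def\<close>)
      also have "\<dots> \<in> span {\<pi> (pel (x, as)) | x as y. walk src tgt x as y}"
      proof (intro span_sum span_scale span_base)
        fix p assume "p \<in> {p. f p \<noteq> 0}"
        then have "valid_path src tgt (fst p, snd p)" using f unfolding pathalg_def prod.collapse by blast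
        then obtain y where "walk src tgt (fst p) (snd p) y" using valid_path_iff_walk by metis
        then show "\<pi> (pel p) \<in> {\<pi> (pel (x, as)) | x as y. walk src tgt x as y}"
          by (metis (mono_tags, lifting) mem_Collect_eq prod.collapse)
      qed
      finally show "u \<in> span {\<pi> (pel (x, as)) | x as y. walk src tgt x as y}" .
    qed simp
    show "\<pi> (pel (x, [])) \<noteq> 0" for x using nz[of x "[]" x] I[of "(x, [])"] by simp
    show "\<pi> (pel (src a, [a])) \<noteq> 0" for a
      using nz[of "src a" "[a]" "tgt a"] I[of "(src a, [a])"] by simp
    show "a = b \<or> b = c \<or> a = c" if "src a = src b" "src b = src c" for a b c
      using three[of "\<lambda>z. src z = src c"] sb that by (auto simp: special_biserial_def)
    show "a = b \<or> b = c \<or> a = c" if "tgt a = tgt b" "tgt b = tgt c" for a b c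
      using three[of "\<lambda>z. tgt z = tgt c"] sb that by (auto simp: special_biserial_def)
    show "b = c" if "src b = tgt a" "src c = tgt a" "\<pi> (pel (src a, [a, b])) \<noteq> 0" "\<pi> (pel (src a, [a, c])) \<noteq> 0"
      for a b c
    proof (rule two)
      show "card {z. src z = tgt a \<and> pel (src a, [a, z]) \<notin> I} \<le> 1"
        using sb by (simp add: special_biserial_def)
    qed (use that nz[of "src a" "[a, b]" "tgt b"] nz[of "src a" "[a, c]" "tgt c"] in auto)
    show "b = c" if "tgt b = src a" "tgt c = src a" "\<pi> (pel (src b, [b, a])) \<noteq> 0" "\<pi> (pel (src c, [c, a])) \<noteq> 0"
      for a b c
    proof (rule two)
      show "card {z. tgt z = src a \<and> pel (src z, [z, a]) \<notin> I} \<le> 1"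
        using sb by (simp add: special_biserial_def)
    qed (use that nz[of "src b" "[b, a]" "tgt a"] nz[of "src c" "[c, a]" "tgt a"] in auto)
  qed
qed

theorem theorem5p2:
  fixes src tgt :: "'a::finite \<Rightarrow> 'v::finite"
    and I :: "(('v,'a) path \<Rightarrow> 'k::field) set"
    and sc :: "'k \<Rightarrow> 'A::ring_1 \<Rightarrow> 'A"
    and \<pi> :: "(('v,'a) path \<Rightarrow> 'k) \<Rightarrow> 'A"
    and sc' :: "'k \<Rightarrow> 'B::ring_1 \<Rightarrow> 'B"
    and q :: "'A \<Rightarrow> 'B"
  assumes alg_closed: "\<forall>p :: 'k poly. 0 < degree p \<longrightarrow> (\<exists>x. poly p x = 0)"
    and sb: "special_biserial src tgt I"
    and no_bypass: "\<not> has_bypass src tgt"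
    and A_alg: "kalg sc"
    and A_pres: "presents src tgt I sc \<pi>"
    and B_alg: "kalg sc'"
    and B_quot: "quotient_map sc sc' (S_ideal sc \<pi>) q"
  shows "\<exists>P :: ('A \<Rightarrow> 'A) \<Rightarrow> ('B \<Rightarrow> 'B).
     (\<forall>D \<in> Der sc. P D \<in> Der sc' \<and>
        (\<exists>a. \<forall>x. P D (q x) = q (D x + (a * x - x * a)))) \<and>
     (\<forall>D \<in> Der sc. P D \<in> Inn \<longrightarrow> D \<in> Inn) \<and>
     (\<forall>D1 \<in> Der sc. \<forall>D2 \<in> Der sc.
        P (commutator D1 D2) - commutator (P D1) (P D2) \<in> Inn) \<and>
     vector_space.dim (fscale sc') (Der sc') =
       vector_space.dim (fscale sc') {E + F | E F. E \<in> P ` Der sc \<and> F \<in> Inn}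
       + vector_space.dim sc (S_ideal sc \<pi>)"
proof -
  let ?M = "\<lambda>x as. \<pi> (pel (x, as))"
  interpret A: special_biserial_algebra sc src tgt ?M
    by (rule presents_special_biserial[OF sb no_bypass A_alg A_pres])
  have S: "S_ideal sc \<pi> = A.S"
    by (simp add: A.S_eq S_ideal_def proj_at_def)
  interpret special_biserial_quotient sc src tgt ?M sc' q
    by unfold_locales (use B_alg B_quot S in auto)
  show ?thesis
  proof (intro exI[of _ P] conjI ballI impI)
    show "P D \<in> Der sc'" if "D \<in> Der sc" for D
      using that by (rule P_Der)
    \<comment> \<open>The map \<open>P D\<close> is induced by \<open>D\<close> itself, so the inner
      correction is 0.\<close>
    show "\<exists>a. \<forall>x. P D (q x) = q (D x + (a * x - x * a))" if "D \<in> Der sc" for D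
      by (rule exI[of _ 0]) (simp add: P_q[OF that])
    show "D \<in> Inn" if "D \<in> Der sc" "P D \<in> Inn" for D
      using inner_of_P_inner[OF that(1)] that(2) by (auto simp: Inn_eq_range)
    show "P (commutator D1 D2) - commutator (P D1) (P D2) \<in> Inn" if "D1 \<in> Der sc" "D2 \<in> Der sc" for D1 D2
    proof -
      have "inner (0::'B) = 0" by (auto simp: inner_def)
      then show ?thesis using P_commutator[OF that] by (auto simp: Inn_eq_range image_iff intro: exI[of _ 0])
    qed
    show "vector_space.dim (fscale sc') (Der sc') =
       vector_space.dim (fscale sc') {E + F | E F. E \<in> P ` Der sc \<and> F \<in> Inn}
       + vector_space.dim sc (S_ideal sc \<pi>)"
      unfolding S by (rule dim_Der)
  qed
qed

end
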